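(* The balanced Schur roots of $\Gamma$ are exactly the balanced $\theta$-stable dimension vectors of $\Gamma$.
   Context: $\mathbb{K}$ is an algebraically closed field, $m\ge 1$, and $A=A_1*\cdots*A_m$ is the free product of finite dimensional semisimple $\mathbb{K}$-algebras $A_i$, none of which is one-dimensional, with $A_i=A_{i1}\times\cdots\times A_{ir_i}$ and $A_{ij}=\mathrm{Mat}_{w_{ij}}(\mathbb{K})$. The quiver $\Gamma=\Gamma_A$ has one sink $v_0$, a source $v_{ij}$ for each $1\le i\le m$, $1\le j\le r_i$, and $w_{ij}$ arrows from $v_{ij}$ to $v_0$. All representations are finite dimensional over $\mathbb{K}$. A dimension vector $d\in\mathbb{Z}_{\ge0}^{\Gamma_0}$ (entries $d_0=d_{v_0}$, $d_{ij}=d_{v_{ij}}$) is balanced if $\sum_{j=1}^{r_i}w_{ij}d_{ij}=d_0$ for every $1\le i\le m$. A dimension vector $d$ is a Schur root if there is a representation $X$ of $\Gamma$ of dimension vector $d$ with $\mathrm{End}(X)=\mathbb{K}$. The stability parameter $\theta\in\mathbb{Z}^{\Gamma_0}$ has $\theta_{v_0}=-m$ and $\theta_{v_{ij}}=w_{ij}$; $\theta(d)=\sum_v\theta_vd_v$. A nonzero representation $X$ is $\theta$-stable if $\theta(\dim X)=0$ and $\theta(\dim X')<0$ for every proper nonzero subrepresentation $X'$ of $X$. A dimension vector is $\theta$-stable if it is the dimension vector of some $\theta$-stable representation. *)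

theory Defs
  imports
    "Jordan_Normal_Form.VS_Connect"
    "Graph_Theory.Digraph"
    "HOL-Library.FuncSet"
begin

text \<open>
  A quiver is a directed multigraph. A representation of a quiver \<open>Q\<close> with dimension vector \<open>d\<close>
  has the vertex spaces \<open>K\<^bsup>d v\<^esup>\<close> and, for every arrow \<open>a\<close>, a linear map given by a matrix of
  format \<open>d (head a) \<times> d (tail a)\<close>; up to isomorphism every finite dimensional representation is of
  this form. Dimension vectors are extended by 0 outside the vertex set, so that equality of
  functions is equality of dimension vectors.
\<close>

definition dim_vectors :: "('v, 'a) pre_digraph \<Rightarrow> ('v \<Rightarrow> nat) set" where
  "dim_vectors Q = {d. \<forall>v. v \<notin> verts Q \<longrightarrow> d v = 0}"

definition is_rep :: "('v, 'a) pre_digraph \<Rightarrow> ('v \<Rightarrow> nat) \<Rightarrow> ('a \<Rightarrow> 'k::field mat) \<Rightarrow> bool" where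
  "is_rep Q d X \<longleftrightarrow> d \<in> dim_vectors Q \<and>
     (\<forall>a\<in>arcs Q. X a \<in> carrier_mat (d (head Q a)) (d (tail Q a)))"

definition End_rep ::
    "('v, 'a) pre_digraph \<Rightarrow> ('v \<Rightarrow> nat) \<Rightarrow> ('a \<Rightarrow> 'k::field mat) \<Rightarrow> ('v \<Rightarrow> 'k mat) set" where
  "End_rep Q d X = {\<phi> \<in> (\<Pi>\<^sub>E v\<in>verts Q. carrier_mat (d v) (d v)).
     \<forall>a\<in>arcs Q. X a * \<phi> (tail Q a) = \<phi> (head Q a) * X a}"

definition scalar_endo ::
    "('v, 'a) pre_digraph \<Rightarrow> ('v \<Rightarrow> nat) \<Rightarrow> 'k::field \<Rightarrow> 'v \<Rightarrow> 'k mat" where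
  "scalar_endo Q d c = (\<lambda>v\<in>verts Q. c \<cdot>\<^sub>m 1\<^sub>m (d v))"

text \<open>
  \<open>End X = K\<close> says that the structure map from \<open>K\<close> to \<open>End X\<close> is bijective. Its injectivity
  excludes the zero representation.
\<close>

definition trivial_End ::
    "('v, 'a) pre_digraph \<Rightarrow> ('v \<Rightarrow> nat) \<Rightarrow> ('a \<Rightarrow> 'k::field mat) \<Rightarrow> bool" where
  "trivial_End Q d X \<longleftrightarrow> bij_betw (scalar_endo Q d) (UNIV :: 'k set) (End_rep Q d X)"

definition schur_root ::
    "'k::field itself \<Rightarrow> ('v, 'a) pre_digraph \<Rightarrow> ('v \<Rightarrow> nat) \<Rightarrow> bool" where
  "schur_root _ Q d \<longleftrightarrow> (\<exists>X :: 'a \<Rightarrow> 'k mat. is_rep Q d X \<and> trivial_End Q d X)"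

definition is_subrep ::
    "('v, 'a) pre_digraph \<Rightarrow> ('v \<Rightarrow> nat) \<Rightarrow> ('a \<Rightarrow> 'k::field mat) \<Rightarrow> ('v \<Rightarrow> 'k vec set) \<Rightarrow> bool" where
  "is_subrep Q d X U \<longleftrightarrow>
     (\<forall>v\<in>verts Q. VectorSpace.subspace class_ring (U v) (module_vec TYPE('k) (d v))) \<and>
     (\<forall>a\<in>arcs Q. \<forall>x\<in>U (tail Q a). X a *\<^sub>v x \<in> U (head Q a))"

definition subrep_dim ::
    "('v, 'a) pre_digraph \<Rightarrow> ('v \<Rightarrow> nat) \<Rightarrow> ('v \<Rightarrow> 'k::field vec set) \<Rightarrow> 'v \<Rightarrow> nat" where
  "subrep_dim Q d U v =
     (if v \<in> verts Q
      then vectorspace.dim class_ring (module_vec TYPE('k) (d v)\<lparr>carrier := U v\<rparr>) else 0)"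

definition weight :: "('v, 'a) pre_digraph \<Rightarrow> ('v \<Rightarrow> int) \<Rightarrow> ('v \<Rightarrow> nat) \<Rightarrow> int" where
  "weight Q \<theta> d = (\<Sum>v\<in>verts Q. \<theta> v * int (d v))"

definition stable_rep ::
    "('v, 'a) pre_digraph \<Rightarrow> ('v \<Rightarrow> int) \<Rightarrow> ('v \<Rightarrow> nat) \<Rightarrow> ('a \<Rightarrow> 'k::field mat) \<Rightarrow> bool" where
  "stable_rep Q \<theta> d X \<longleftrightarrow>
     (\<exists>v\<in>verts Q. d v \<noteq> 0) \<and> weight Q \<theta> d = 0 \<and>
     (\<forall>U. is_subrep Q d X U \<and>
          (\<exists>v\<in>verts Q. U v \<noteq> {0\<^sub>v (d v)}) \<and>
          (\<exists>v\<in>verts Q. U v \<noteq> carrier_vec (d v)) \<longrightarrow>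
          weight Q \<theta> (subrep_dim Q d U) < 0)"

definition stable_dim_vector ::
    "'k::field itself \<Rightarrow> ('v, 'a) pre_digraph \<Rightarrow> ('v \<Rightarrow> int) \<Rightarrow> ('v \<Rightarrow> nat) \<Rightarrow> bool" where
  "stable_dim_vector _ Q \<theta> d \<longleftrightarrow> (\<exists>X :: 'a \<Rightarrow> 'k mat. is_rep Q d X \<and> stable_rep Q \<theta> d X)"


text \<open>
  The algebra \<open>A = A\<^sub>1 * \<dots> * A\<^sub>m\<close> with \<open>A\<^sub>i = Mat\<^bsub>w i 1\<^esub>(K) \<times> \<dots> \<times> Mat\<^bsub>w i (r i)\<^esub>(K)\<close> enters
  only through \<open>m\<close>, \<open>r\<close> and \<open>w\<close>, with indices starting at 1. The \<open>k\<close>-th arrow from the source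
  \<open>Source i j\<close> to the sink is the triple \<open>(i, j, k)\<close>.
\<close>

datatype gamma_vertex = Sink | Source nat nat

definition Gamma ::
    "nat \<Rightarrow> (nat \<Rightarrow> nat) \<Rightarrow> (nat \<Rightarrow> nat \<Rightarrow> nat) \<Rightarrow> (gamma_vertex, nat \<times> nat \<times> nat) pre_digraph" where
  "Gamma m r w =
     \<lparr> verts = insert Sink {Source i j | i j. i \<in> {1..m} \<and> j \<in> {1..r i}},
       arcs = {(i, j, k). i \<in> {1..m} \<and> j \<in> {1..r i} \<and> k \<in> {1..w i j}},
       tail = (\<lambda>(i, j, k). Source i j),
       head = (\<lambda>_. Sink) \<rparr>"

text \<open>The dimension of \<open>A\<^sub>i\<close>: the factor \<open>Mat\<^bsub>w i j\<^esub>(K)\<close> has dimension \<open>(w i j)\<^sup>2\<close>.\<close>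

definition factor_dim :: "(nat \<Rightarrow> nat) \<Rightarrow> (nat \<Rightarrow> nat \<Rightarrow> nat) \<Rightarrow> nat \<Rightarrow> nat" where
  "factor_dim r w i = (\<Sum>j = 1..r i. (w i j)\<^sup>2)"

definition balanced ::
    "nat \<Rightarrow> (nat \<Rightarrow> nat) \<Rightarrow> (nat \<Rightarrow> nat \<Rightarrow> nat) \<Rightarrow> (gamma_vertex \<Rightarrow> nat) \<Rightarrow> bool" where
  "balanced m r w d \<longleftrightarrow> d \<in> dim_vectors (Gamma m r w) \<and>
     (\<forall>i\<in>{1..m}. (\<Sum>j = 1..r i. w i j * d (Source i j)) = d Sink)"

fun gamma_theta :: "nat \<Rightarrow> (nat \<Rightarrow> nat \<Rightarrow> nat) \<Rightarrow> gamma_vertex \<Rightarrow> int" where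
  "gamma_theta m w Sink = - int m"
| "gamma_theta m w (Source i j) = int (w i j)"

lemma fin_digraph_Gamma: "fin_digraph (Gamma m r w)"
proof
  have "verts (Gamma m r w) = insert Sink (\<Union>i\<in>{1..m}. Source i ` {1..r i})"
    by (auto simp: Gamma_def)
  then show "finite (verts (Gamma m r w))"
    by simp
  have "arcs (Gamma m r w) = (SIGMA i:{1..m}. SIGMA j:{1..r i}. {1..w i j})"
    by (auto simp: Gamma_def)
  then show "finite (arcs (Gamma m r w))"
    by simp
qed (auto simp: Gamma_def)

end

theory Submission
  imports Defs "Jordan_Normal_Form.Char_Poly"
begin

text \<open>
  A stable representation has only scalar endomorphisms by Schur's lemma, \<open>stable_trivial_End\<close>; this
  half holds for every finite quiver.

  For the converse, let \<open>d\<close> be balanced and let there be a representation of dimension \<open>d\<close> with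
  trivial endomorphism ring. A generic representation \<open>X\<close> of dimension \<open>d\<close> then has three properties.
  It again has trivial endomorphism ring (\<open>generically_brick\<close>). For each \<open>i\<close>, the arrows of the \<open>i\<close>-th
  factor assemble to an injective map from the sum of \<open>w i j\<close> copies of each space at \<open>Source i j\<close>
  to the space at the sink (\<open>generically_block_injective\<close>). Finally, if \<open>e\<close> is the dimension of a
  proper nonzero subrepresentation of \<open>X\<close>, then \<open>\<langle>e, d - e\<rangle> > \<langle>d - e, e\<rangle>\<close>
  (\<open>generically_canonically_stable\<close>). Here \<open>\<langle>x, y\<rangle>\<close> is the Euler form, the sum of \<open>x v * y v\<close> over the
  vertices minus the sum of \<open>x (tail a) * y (head a)\<close> over the arrows. The second
  property makes \<open>X\<close> semistable, with weight 0 only for balanced \<open>e\<close>. On balanced vectors the Euler form is symmetric, so the third property excludes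
  balanced \<open>e\<close>, and \<open>X\<close> is stable.

  The third property holds for every finite quiver and follows from two estimates. The inequality
  \<open>\<langle>e, d - e\<rangle> \<ge> 0\<close> is a dimension count: pairs of a representation and a subrepresentation of dimension
  \<open>e\<close> form a family whose dimension exceeds that of the representation space by \<open>\<langle>e, d - e\<rangle>\<close>, so if
  this number is negative, they do not reach the generic representation
  (\<open>generically_no_subrepresentation\<close>). The inequality \<open>\<langle>d - e, e\<rangle> < 0\<close> holds because otherwise a linear
  system with more unknowns than equations produces a nonscalar endomorphism with image in the
  subrepresentation (\<open>brick_subrepresentation\<close>).

  The algebraic geometry is elementary. Open sets are replaced by sets that contain all but finitely
  many points of every line that meets them (\<open>line_open\<close>), and the dimension count by comparing numbers
  of monomials (\<open>generically_not_in_image\<close>).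
\<close>

section \<open>Linear systems\<close>

definition linear_form :: "(('i \<Rightarrow> 'k::field) \<Rightarrow> 'k) \<Rightarrow> bool" where
  "linear_form L \<longleftrightarrow> (\<forall>x y. L (\<lambda>i. x i + y i) = L x + L y) \<and> (\<forall>c x. L (\<lambda>i. c * x i) = c * L x)"

text \<open>
  The unknowns of a system are functions on a whole type that vanish outside a finite index set \<open>I\<close>;
  this keeps addition and scaling of solutions pointwise.
\<close>

definition supported_on :: "'i set \<Rightarrow> ('i \<Rightarrow> 'k::zero) \<Rightarrow> bool" where
  "supported_on I x \<longleftrightarrow> (\<forall>i. i \<notin> I \<longrightarrow> x i = 0)"

definition unit_at :: "'i \<Rightarrow> 'i \<Rightarrow> 'k::zero_neq_one" where
  "unit_at i = (\<lambda>l. if l = i then 1 else 0)"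

lemma linear_form_add: "linear_form L \<Longrightarrow> L (\<lambda>i. x i + y i) = L x + L y"
  and linear_form_scale: "linear_form L \<Longrightarrow> L (\<lambda>i. c * x i) = c * L x"
  by (simp_all add: linear_form_def)

lemma linear_form_coord: "linear_form (\<lambda>x. x i)"
  by (simp add: linear_form_def)

lemma linear_form_const_zero: "linear_form (\<lambda>x. 0)"
  by (simp add: linear_form_def)

lemma linear_form_cmult: "linear_form L \<Longrightarrow> linear_form (\<lambda>x. c * L x)"
  by (auto simp: linear_form_def algebra_simps)

lemma linear_form_multc: "linear_form L \<Longrightarrow> linear_form (\<lambda>x. L x * c)"
  by (auto simp: linear_form_def algebra_simps)

lemma linear_form_diff: "linear_form L \<Longrightarrow> linear_form M \<Longrightarrow> linear_form (\<lambda>x. L x - M x)"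
  unfolding linear_form_def by (simp add: algebra_simps)

lemma linear_form_sum: "(\<And>j. j \<in> J \<Longrightarrow> linear_form (L j)) \<Longrightarrow> linear_form (\<lambda>x. \<Sum>j\<in>J. L j x)"
  unfolding linear_form_def by (simp add: sum.distrib sum_distrib_left)

lemmas linear_form_intros = linear_form_coord linear_form_const_zero linear_form_cmult
  linear_form_multc linear_form_diff linear_form_sum

lemma linear_form_zero: "linear_form L \<Longrightarrow> L (\<lambda>i. 0) = 0"
  using linear_form_scale[of L 0 "\<lambda>i. 0"] by simp

lemma linear_form_expand:
  fixes L :: "('i \<Rightarrow> 'k::field) \<Rightarrow> 'k"
  assumes L: "linear_form L" and "finite I" "supported_on I x"
  shows "L x = (\<Sum>i\<in>I. L (unit_at i) * x i)"
proof -
  have "L (\<lambda>l. \<Sum>i\<in>J. x i * unit_at i l) = (\<Sum>i\<in>J. L (unit_at i) * x i)" if "finite J" for J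
    using that
  proof induction
    case empty
    show ?case using linear_form_zero[OF L] by simp
  next
    case (insert a J)
    have "L (\<lambda>l. x a * unit_at a l + (\<Sum>i\<in>J. x i * unit_at i l)) =
        L (\<lambda>l. x a * unit_at a l) + L (\<lambda>l. \<Sum>i\<in>J. x i * unit_at i l)"
      by (rule linear_form_add[OF L])
    moreover have "L (\<lambda>l. x a * unit_at a l) = x a * L (unit_at a)"
      by (rule linear_form_scale[OF L])
    ultimately show ?case using insert by (simp add: mult.commute)
  qed
  moreover have "(\<lambda>l. \<Sum>i\<in>I. x i * unit_at i l) = x"
  proof
    fix l
    have "(\<Sum>i\<in>I. x i * unit_at i l) = (\<Sum>i\<in>I. if i = l then x i else 0)"
      by (rule sum.cong) (auto simp: unit_at_def)
    then show "(\<Sum>i\<in>I. x i * unit_at i l) = x l"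
      using assms by (auto simp: supported_on_def)
  qed
  ultimately show ?thesis using assms(2) by metis
qed

text \<open>
  Gaussian elimination: an equation with a nonzero coefficient is used to remove one unknown from the
  others, so that equations and unknowns drop together.
\<close>
lemma underdetermined_coefficients:
  fixes M :: "'j \<Rightarrow> 'i \<Rightarrow> 'k::field"
  assumes "finite J" "finite I" "card J < card I"
  shows "\<exists>x. supported_on I x \<and> (\<exists>i\<in>I. x i \<noteq> 0) \<and> (\<forall>j\<in>J. (\<Sum>i\<in>I. M j i * x i) = 0)"
  using assms
proof (induction J arbitrary: I M rule: finite_induct)
  case empty
  then obtain i where "i \<in> I" by fastforce
  then show ?case by (intro exI[of _ "unit_at i"]) (auto simp: supported_on_def unit_at_def)
next
  case (insert j J)
  show ?case
  proof (cases "\<forall>i\<in>I. M j i = 0")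
    case True
    have "card J < card I" using insert by simp
    then obtain x where "supported_on I x" "\<exists>i\<in>I. x i \<noteq> 0"
      "\<forall>j\<in>J. (\<Sum>i\<in>I. M j i * x i) = 0"
      using insert.IH[of I M] insert.prems by blast
    then show ?thesis using True by (intro exI[of _ x]) auto
  next
    case False
    then obtain a where a: "a \<in> I" "M j a \<noteq> 0" by blast
    let ?I = "I - {a}"
    have "card J < card ?I" using insert a by simp
    then obtain y where y: "supported_on ?I y" "\<exists>i\<in>?I. y i \<noteq> 0"
      "\<forall>l\<in>J. (\<Sum>i\<in>?I. (M j a * M l i - M l a * M j i) * y i) = 0"
      using insert.IH[of ?I "\<lambda>l i. M j a * M l i - M l a * M j i"] insert.prems by auto
    \<comment> \<open>back substitution into the pivot equation \<open>j\<close>\<close>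
    define s where "s = (\<Sum>i\<in>?I. M j i * y i)"
    define x where "x = (\<lambda>i. if i = a then - s / M j a else y i)"
    have x_sum: "(\<Sum>i\<in>I. M l i * x i) = M l a * (- s / M j a) + (\<Sum>i\<in>?I. M l i * y i)" for l
    proof -
      have "(\<Sum>i\<in>I. M l i * x i) = M l a * x a + (\<Sum>i\<in>?I. M l i * x i)"
        using a insert.prems by (simp add: sum.remove)
      also have "(\<Sum>i\<in>?I. M l i * x i) = (\<Sum>i\<in>?I. M l i * y i)"
        by (rule sum.cong) (auto simp: x_def)
      finally show ?thesis by (simp add: x_def)
    qed
    have "(\<Sum>i\<in>I. M l i * x i) = 0" if "l \<in> J" for l
    proof -
      have "M j a * (\<Sum>i\<in>?I. M l i * y i) - M l a * s = 0"
        using y(3) that by (simp add: s_def sum_distrib_left left_diff_distrib sum_subtractf mult.assoc)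
      then show ?thesis unfolding x_sum using a by (simp add: field_simps)
    qed
    moreover have "(\<Sum>i\<in>I. M j i * x i) = 0"
      unfolding x_sum using a by (simp add: s_def)
    moreover have "supported_on I x" "\<exists>i\<in>I. x i \<noteq> 0"
      using y a by (auto simp: supported_on_def x_def)
    ultimately show ?thesis by (intro exI[of _ x]) auto
  qed
qed

lemma underdetermined_system:
  fixes L :: "'j \<Rightarrow> ('i \<Rightarrow> 'k::field) \<Rightarrow> 'k"
  assumes "finite J" "finite I" "card J < card I" "\<And>j. j \<in> J \<Longrightarrow> linear_form (L j)"
  shows "\<exists>x. supported_on I x \<and> (\<exists>i\<in>I. x i \<noteq> 0) \<and> (\<forall>j\<in>J. L j x = 0)"
proof -
  obtain x where "supported_on I x" "\<exists>i\<in>I. x i \<noteq> 0"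
    "\<forall>j\<in>J. (\<Sum>i\<in>I. L j (unit_at i) * x i) = 0"
    using underdetermined_coefficients[OF assms(1-3), of "\<lambda>j i. L j (unit_at i)"] by blast
  then show ?thesis
    using linear_form_expand[OF assms(4) assms(2)] by (intro exI[of _ x]) auto
qed

section \<open>Generic points of an affine space\<close>

definition segment :: "('i \<Rightarrow> 'k::field) \<Rightarrow> ('i \<Rightarrow> 'k) \<Rightarrow> 'k \<Rightarrow> 'i \<Rightarrow> 'k" where
  "segment f g t = (\<lambda>i. f i + t * (g i - f i))"

text \<open>
  A substitute for Zariski open sets that only speaks of polynomials in one variable: on a line that
  meets the set, all but finitely many points belong to it. Over an infinite field two nonempty such
  sets meet, because on a line through a point of each both complements are finite.
\<close>
definition line_open :: "('i \<Rightarrow> 'k::field) set \<Rightarrow> bool" where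
  "line_open T \<longleftrightarrow> (\<forall>f g s. segment f g s \<in> T \<longrightarrow> finite {t. segment f g t \<notin> T})"

definition generically :: "(('i \<Rightarrow> 'k::field) \<Rightarrow> bool) \<Rightarrow> bool" where
  "generically P \<longleftrightarrow> (\<exists>T. line_open T \<and> T \<noteq> {} \<and> (\<forall>f\<in>T. P f))"

lemma generically_mono: "generically P \<Longrightarrow> (\<And>f. P f \<Longrightarrow> Q f) \<Longrightarrow> generically Q"
  unfolding generically_def by blast

lemma generically_True: "generically (\<lambda>f. True)"
  unfolding generically_def by (intro exI[of _ UNIV]) (auto simp: line_open_def)

lemma generically_ex: "generically P \<Longrightarrow> \<exists>f. P f"
  unfolding generically_def by blast

lemma generically_conj:
  fixes P Q :: "('i \<Rightarrow> 'k::field) \<Rightarrow> bool"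
  assumes inf: "infinite (UNIV :: 'k set)" and "generically P" "generically Q"
  shows "generically (\<lambda>f. P f \<and> Q f)"
proof -
  obtain S T where S: "line_open S" "S \<noteq> {}" "\<forall>f\<in>S. P f" and T: "line_open T" "T \<noteq> {}" "\<forall>f\<in>T. Q f"
    using assms(2,3) unfolding generically_def by blast
  have un: "{t. segment f g t \<notin> S \<inter> T} = {t. segment f g t \<notin> S} \<union> {t. segment f g t \<notin> T}" for f g
    by auto
  have "line_open (S \<inter> T)"
    unfolding line_open_def un using S(1) T(1) unfolding line_open_def by blast
  moreover obtain f g where fg: "f \<in> S" "g \<in> T" using S T by blast
  have "segment f g 0 \<in> S" "segment f g 1 \<in> T" using fg by (auto simp: segment_def)
  then have "finite {t. segment f g t \<notin> S \<inter> T}"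
    unfolding un using S(1) T(1) unfolding line_open_def by blast
  then have "{t. segment f g t \<notin> S \<inter> T} \<noteq> UNIV" using inf by metis
  then have "S \<inter> T \<noteq> {}" by blast
  ultimately show ?thesis unfolding generically_def using S T by (intro exI[of _ "S \<inter> T"]) auto
qed

lemma generically_ball:
  fixes P :: "'j \<Rightarrow> ('i \<Rightarrow> 'k::field) \<Rightarrow> bool"
  assumes inf: "infinite (UNIV :: 'k set)" and "finite J" "\<And>j. j \<in> J \<Longrightarrow> generically (P j)"
  shows "generically (\<lambda>f. \<forall>j\<in>J. P j f)"
  using assms(2,3)
proof induction
  case empty
  show ?case using generically_True by simp
next
  case (insert j J)
  then show ?case using generically_conj[OF inf, of "P j" "\<lambda>f. \<forall>j\<in>J. P j f"] by simp
qed

text \<open>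
  Eliminating one unknown
  without division keeps the coefficients polynomial in the parameter; the new system is injective
  wherever the old one is and the pivot does not vanish, and conversely.
\<close>
lemma cofinitely_injective:
  fixes M :: "'j \<Rightarrow> 'i \<Rightarrow> 'k::field poly"
  assumes "finite I"
    and "\<And>x. \<forall>j\<in>J. (\<Sum>i\<in>I. poly (M j i) s * x i) = 0 \<Longrightarrow> \<forall>i\<in>I. x i = 0"
  shows "finite {t. \<not> (\<forall>x. (\<forall>j\<in>J. (\<Sum>i\<in>I. poly (M j i) t * x i) = 0) \<longrightarrow> (\<forall>i\<in>I. x i = 0))}"
  using assms
proof (induction I arbitrary: M rule: finite_induct)
  case empty
  then show ?case by simp
next
  case (insert a I)
  \<comment> \<open>otherwise the unit vector at \<open>a\<close> solves the system at \<open>s\<close>\<close>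
  have "\<exists>j\<in>J. poly (M j a) s \<noteq> 0"
  proof (rule ccontr)
    assume *: "\<not> (\<exists>j\<in>J. poly (M j a) s \<noteq> 0)"
    have "(\<Sum>i\<in>insert a I. poly (M j i) s * unit_at a i) = 0" if "j \<in> J" for j
      using * that insert.hyps
      by (intro sum.neutral) (auto simp: unit_at_def)
    then show False using insert.prems[of "unit_at a"] by (auto simp: unit_at_def)
  qed
  then obtain b where b: "b \<in> J" "poly (M b a) s \<noteq> 0" by blast
  define M' where "M' = (\<lambda>j i. M b a * M j i - M j a * M b i)"
  have M': "(\<Sum>i\<in>I. poly (M' j i) t * x i) =
      poly (M b a) t * (\<Sum>i\<in>I. poly (M j i) t * x i) - poly (M j a) t * (\<Sum>i\<in>I. poly (M b i) t * x i)"
    for j t x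
    by (simp add: M'_def sum_distrib_left left_diff_distrib sum_subtractf mult.assoc)
  have "\<forall>i\<in>I. y i = 0" if y: "\<forall>j\<in>J. (\<Sum>i\<in>I. poly (M' j i) s * y i) = 0" for y
  proof -
    define c where "c = - (\<Sum>i\<in>I. poly (M b i) s * y i) / poly (M b a) s"
    have sm: "(\<Sum>i\<in>I. poly (M j i) s * (y(a := c)) i) = (\<Sum>i\<in>I. poly (M j i) s * y i)" for j
      using insert.hyps by (intro sum.cong) auto
    have "(\<Sum>i\<in>insert a I. poly (M j i) s * (y(a := c)) i) = 0" if "j \<in> J" for j
    proof -
      have "(\<Sum>i\<in>insert a I. poly (M j i) s * (y(a := c)) i) =
          poly (M j a) s * c + (\<Sum>i\<in>I. poly (M j i) s * y i)"
        using insert.hyps sm by simp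
      then show ?thesis using y that b(2) unfolding M' c_def by (simp add: field_simps)
    qed
    then have "\<forall>i\<in>insert a I. (y(a := c)) i = 0" using insert.prems by blast
    then show ?thesis using insert.hyps by (auto split: if_splits)
  qed
  then have "finite {t. \<not> (\<forall>x. (\<forall>j\<in>J. (\<Sum>i\<in>I. poly (M' j i) t * x i) = 0) \<longrightarrow> (\<forall>i\<in>I. x i = 0))}"
    by (rule insert.IH)
  moreover have "finite {t. poly (M b a) t = 0}"
    using b(2) poly_roots_finite[of "M b a"] by fastforce
  moreover have "{t. \<not> (\<forall>x. (\<forall>j\<in>J. (\<Sum>i\<in>insert a I. poly (M j i) t * x i) = 0) \<longrightarrow> (\<forall>i\<in>insert a I. x i = 0))}
      \<subseteq> {t. \<not> (\<forall>x. (\<forall>j\<in>J. (\<Sum>i\<in>I. poly (M' j i) t * x i) = 0) \<longrightarrow> (\<forall>i\<in>I. x i = 0))} \<union>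
        {t. poly (M b a) t = 0}"
  proof (intro subsetI, rule ccontr)
    fix t
    assume t1: "t \<in> {t. \<not> (\<forall>x. (\<forall>j\<in>J. (\<Sum>i\<in>insert a I. poly (M j i) t * x i) = 0) \<longrightarrow> (\<forall>i\<in>insert a I. x i = 0))}"
      and t2: "t \<notin> {t. \<not> (\<forall>x. (\<forall>j\<in>J. (\<Sum>i\<in>I. poly (M' j i) t * x i) = 0) \<longrightarrow> (\<forall>i\<in>I. x i = 0))} \<union>
        {t. poly (M b a) t = 0}"
    obtain x where x: "\<forall>j\<in>J. (\<Sum>i\<in>insert a I. poly (M j i) t * x i) = 0" "\<exists>i\<in>insert a I. x i \<noteq> 0"
      using t1 by blast
    have s: "(\<Sum>i\<in>I. poly (M j i) t * x i) = - poly (M j a) t * x a" if "j \<in> J" for j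
      using x(1) that insert.hyps by (simp add: eq_neg_iff_add_eq_0 add.commute)
    have "(\<Sum>i\<in>I. poly (M' j i) t * x i) = 0" if "j \<in> J" for j
      unfolding M' using s[OF that] s[OF b(1)] by simp
    then have z: "\<forall>i\<in>I. x i = 0" using t2 by blast
    then have "poly (M b a) t * x a = 0" using s[OF b(1)] by simp
    then show False using x(2) z t2 by auto
  qed
  ultimately show ?case by (meson finite_Un finite_subset)
qed

text \<open>
  Along a line the coefficients of a family of linear systems that depends affinely on the point are
  polynomials of degree at most 1, so one injective member makes the generic member injective.
\<close>
lemma generically_injective:
  fixes L :: "('i \<Rightarrow> 'k::field) \<Rightarrow> 'j \<Rightarrow> ('l \<Rightarrow> 'k) \<Rightarrow> 'k"
  assumes fin: "finite I"
    and lin: "\<And>f j. j \<in> J \<Longrightarrow> linear_form (L f j)"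
    and aff: "\<And>f g t j x. j \<in> J \<Longrightarrow> L (segment f g t) j x = L f j x + t * (L g j x - L f j x)"
    and inj: "\<And>x. supported_on I x \<Longrightarrow> \<forall>j\<in>J. L f0 j x = 0 \<Longrightarrow> \<forall>i. x i = 0"
  shows "generically (\<lambda>f. \<forall>x. supported_on I x \<longrightarrow> (\<forall>j\<in>J. L f j x = 0) \<longrightarrow> (\<forall>i. x i = 0))"
proof -
  define T where "T = {f. \<forall>x. supported_on I x \<longrightarrow> (\<forall>j\<in>J. L f j x = 0) \<longrightarrow> (\<forall>i. x i = 0)}"
  have "line_open T"
    unfolding line_open_def
  proof (intro allI impI)
    fix f g s assume s: "segment f g s \<in> T"
    define M where "M = (\<lambda>j i. [: L f j (unit_at i), L g j (unit_at i) - L f j (unit_at i) :])"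
    have M: "(\<Sum>i\<in>I. poly (M j i) t * x i) = L (segment f g t) j x"
      if "j \<in> J" "supported_on I x" for j t x
      unfolding linear_form_expand[OF lin[OF that(1)] fin that(2)]
      using that by (simp add: M_def aff)
    have T: "segment f g t \<in> T \<longleftrightarrow>
      (\<forall>x. (\<forall>j\<in>J. (\<Sum>i\<in>I. poly (M j i) t * x i) = 0) \<longrightarrow> (\<forall>i\<in>I. x i = 0))" for t
    proof
      assume t: "segment f g t \<in> T"
      show "\<forall>x. (\<forall>j\<in>J. (\<Sum>i\<in>I. poly (M j i) t * x i) = 0) \<longrightarrow> (\<forall>i\<in>I. x i = 0)"
      proof (intro allI impI)
        fix x assume x: "\<forall>j\<in>J. (\<Sum>i\<in>I. poly (M j i) t * x i) = 0"
        define y where "y = (\<lambda>i. if i \<in> I then x i else 0)"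
        have y: "supported_on I y" by (simp add: y_def supported_on_def)
        have "L (segment f g t) j y = 0" if "j \<in> J" for j
        proof -
          have "L (segment f g t) j y = (\<Sum>i\<in>I. poly (M j i) t * y i)" using M[OF that y] by simp
          also have "\<dots> = (\<Sum>i\<in>I. poly (M j i) t * x i)" by (simp add: y_def)
          finally show ?thesis using x that by simp
        qed
        then have "\<forall>i. y i = 0" using t y by (simp add: T_def)
        then show "\<forall>i\<in>I. x i = 0" by (metis y_def)
      qed
    next
      assume "\<forall>x. (\<forall>j\<in>J. (\<Sum>i\<in>I. poly (M j i) t * x i) = 0) \<longrightarrow> (\<forall>i\<in>I. x i = 0)"
      then show "segment f g t \<in> T"
        using M by (simp add: T_def) (metis supported_on_def)
    qed
    show "finite {t. segment f g t \<notin> T}"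
      unfolding T by (rule cofinitely_injective[OF fin, of J M s]) (use s in \<open>unfold T, blast\<close>)
  qed
  moreover have "f0 \<in> T" using inj by (auto simp: T_def)
  ultimately show ?thesis unfolding generically_def T_def by blast
qed

section \<open>Images of polynomial maps\<close>

definition monomial :: "'i set \<Rightarrow> ('i \<Rightarrow> nat) \<Rightarrow> ('i \<Rightarrow> 'k::field) \<Rightarrow> 'k" where
  "monomial B e y = (\<Prod>i\<in>B. y i ^ e i)"

text \<open>
  Polynomial functions in the variables \<open>B\<close> with every single exponent at most \<open>n\<close>. Bounding each
  exponent separately, rather than the total degree, makes the number of monomials a power.
\<close>
inductive poly_fun :: "'i set \<Rightarrow> nat \<Rightarrow> (('i \<Rightarrow> 'k::field) \<Rightarrow> 'k) \<Rightarrow> bool" for B n where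
  zero: "poly_fun B n (\<lambda>y. 0)"
| add_monomial: "poly_fun B n h \<Longrightarrow> (\<And>i. i \<in> B \<Longrightarrow> e i \<le> n) \<Longrightarrow>
    poly_fun B n (\<lambda>y. c * monomial B e y + h y)"

lemma poly_fun_mono: "poly_fun B n h \<Longrightarrow> n \<le> k \<Longrightarrow> poly_fun B k h"
  by (induction rule: poly_fun.induct) (auto intro!: poly_fun.intros intro: order_trans)

lemma poly_fun_monomial:
  assumes "\<And>i. i \<in> B \<Longrightarrow> e i \<le> n"
  shows "poly_fun B n (\<lambda>y. c * monomial B e y)"
  using add_monomial[OF zero, of B e n c] assms by simp

lemma poly_fun_const: "poly_fun B n (\<lambda>y. c)"
  using poly_fun_monomial[of B "\<lambda>i. 0" n c] by (simp add: monomial_def)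

lemma poly_fun_coordinate:
  assumes "finite B" "b \<in> B" "1 \<le> n"
  shows "poly_fun B n (\<lambda>y. y b)"
proof -
  have "monomial B (\<lambda>i. if i = b then 1 else 0) y = y b" for y :: "'a \<Rightarrow> 'b"
  proof -
    have "monomial B (\<lambda>i. if i = b then 1 else 0) y = (\<Prod>i\<in>B. if i = b then y i else 1)"
      unfolding monomial_def by (rule prod.cong) auto
    then show ?thesis using assms by simp
  qed
  then have "(\<lambda>y :: 'a \<Rightarrow> 'b. y b) = (\<lambda>y. 1 * monomial B (\<lambda>i. if i = b then 1 else 0) y)" by simp
  moreover have "poly_fun B n \<dots>" using assms by (intro poly_fun_monomial) auto
  ultimately show ?thesis by metis
qed

lemma poly_fun_add: "poly_fun B n h \<Longrightarrow> poly_fun B n k \<Longrightarrow> poly_fun B n (\<lambda>y. h y + k y)"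
  by (induction rule: poly_fun.induct) (auto simp: add.assoc intro: poly_fun.intros)

lemma poly_fun_monomial_mult:
  assumes "poly_fun B n h" "\<And>i. i \<in> B \<Longrightarrow> e i \<le> k"
  shows "poly_fun B (k + n) (\<lambda>y. c * monomial B e y * h y)"
  using assms(1)
proof induction
  case zero
  show ?case using poly_fun.zero by simp
next
  case (add_monomial h e' c')
  have "monomial B (\<lambda>i. e i + e' i) y = monomial B e y * monomial B e' y" for y :: "'a \<Rightarrow> 'b"
    by (simp add: monomial_def power_add prod.distrib)
  moreover have "poly_fun B (k + n)
      (\<lambda>y. (c * c') * monomial B (\<lambda>i. e i + e' i) y + c * monomial B e y * h y)"
    using add_monomial assms(2) by (intro poly_fun.add_monomial) (auto intro: add_mono)
  ultimately show ?case by (simp add: algebra_simps)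
qed

lemma poly_fun_mult:
  assumes "poly_fun B k g" "poly_fun B n h"
  shows "poly_fun B (k + n) (\<lambda>y. g y * h y)"
  using assms(1)
proof induction
  case zero
  show ?case using poly_fun.zero by simp
next
  case (add_monomial g e c)
  then show ?case
    using poly_fun_add[OF poly_fun_monomial_mult[OF assms(2), of e k c] add_monomial.IH]
    by (simp add: distrib_right)
qed

lemma poly_fun_uminus: "poly_fun B n h \<Longrightarrow> poly_fun B n (\<lambda>y. - h y)"
  using poly_fun_mult[OF poly_fun_const, of B n h 0 "-1"] by simp

lemma poly_fun_sum:
  "finite J \<Longrightarrow> (\<And>j. j \<in> J \<Longrightarrow> poly_fun B n (h j)) \<Longrightarrow> poly_fun B n (\<lambda>y. \<Sum>j\<in>J. h j y)"
  by (induction rule: finite_induct) (auto intro: poly_fun.zero poly_fun_add)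

lemma poly_fun_power: "poly_fun B n h \<Longrightarrow> poly_fun B (k * n) (\<lambda>y. h y ^ k)"
  by (induction k) (auto intro: poly_fun_const poly_fun_mult)

lemma poly_fun_prod:
  "finite J \<Longrightarrow> (\<And>j. j \<in> J \<Longrightarrow> poly_fun B n (h j)) \<Longrightarrow> poly_fun B (card J * n) (\<lambda>y. \<Prod>j\<in>J. h j y)"
  by (induction rule: finite_induct) (auto intro: poly_fun_const poly_fun_mult)

definition exponents :: "'i set \<Rightarrow> nat \<Rightarrow> ('i \<Rightarrow> nat) set" where
  "exponents B n = (\<Pi>\<^sub>E i\<in>B. {..n})"

lemma finite_exponents: "finite B \<Longrightarrow> finite (exponents B n)"
  by (simp add: exponents_def finite_PiE)

lemma card_exponents: "finite B \<Longrightarrow> card (exponents B n) = Suc n ^ card B"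
  by (simp add: exponents_def card_PiE)

lemma poly_fun_coefficients:
  assumes "finite B" "poly_fun B n h"
  shows "\<exists>c. \<forall>y. h y = (\<Sum>e\<in>exponents B n. c e * monomial B e y)"
  using assms(2)
proof induction
  case zero
  show ?case by (intro exI[of _ "\<lambda>e. 0"]) simp
next
  case (add_monomial h e c)
  then obtain c' where c': "\<And>y. h y = (\<Sum>e\<in>exponents B n. c' e * monomial B e y)" by blast
  define e' where "e' = restrict e B"
  have e': "e' \<in> exponents B n" "monomial B e' y = monomial B e y" for y :: "'a \<Rightarrow> 'b"
    using add_monomial by (auto simp: e'_def exponents_def monomial_def)
  have "c * monomial B e y + h y =
      (\<Sum>f\<in>exponents B n. (c' f + (if f = e' then c else 0)) * monomial B f y)" for y
  proof -
    have "(\<Sum>f\<in>exponents B n. (if f = e' then c else 0) * monomial B f y) =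
        (\<Sum>f\<in>exponents B n. if f = e' then c * monomial B f y else 0)"
      by (rule sum.cong) auto
    then show ?thesis
      using e' finite_exponents[OF assms(1)] by (simp add: c' distrib_right sum.distrib)
  qed
  then show ?case by (intro exI[of _ "\<lambda>f. c' f + (if f = e' then c else 0)"]) blast
qed

lemma poly_fun_dependence:
  fixes h :: "'e \<Rightarrow> ('i \<Rightarrow> 'k::field) \<Rightarrow> 'k"
  assumes "finite B" "finite E" "\<And>e. e \<in> E \<Longrightarrow> poly_fun B n (h e)" "Suc n ^ card B < card E"
  shows "\<exists>c. (\<exists>e\<in>E. c e \<noteq> 0) \<and> (\<forall>y. (\<Sum>e\<in>E. c e * h e y) = 0)"
proof -
  have "\<forall>e\<in>E. \<exists>a. \<forall>y. h e y = (\<Sum>m\<in>exponents B n. a m * monomial B m y)"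
    using poly_fun_coefficients[OF assms(1) assms(3)] by blast
  then obtain a where a: "\<And>e y. e \<in> E \<Longrightarrow> h e y = (\<Sum>m\<in>exponents B n. a e m * monomial B m y)"
    by metis
  obtain c where c: "\<exists>e\<in>E. c e \<noteq> 0" "\<forall>m\<in>exponents B n. (\<Sum>e\<in>E. a e m * c e) = 0"
    using underdetermined_coefficients[of "exponents B n" E "\<lambda>m e. a e m"] assms
    by (auto simp: finite_exponents card_exponents)
  have "(\<Sum>e\<in>E. c e * h e y) = 0" for y
  proof -
    have "(\<Sum>e\<in>E. c e * h e y) = (\<Sum>e\<in>E. \<Sum>m\<in>exponents B n. (a e m * c e) * monomial B m y)"
      by (rule sum.cong) (simp_all add: a sum_distrib_left mult_ac)
    also have "\<dots> = (\<Sum>m\<in>exponents B n. (\<Sum>e\<in>E. a e m * c e) * monomial B m y)"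
      by (subst sum.swap) (simp add: sum_distrib_right)
    finally show ?thesis using c(2) by simp
  qed
  then show ?thesis using c(1) by blast
qed

lemma univariate_coefficients_zero:
  fixes a :: "nat \<Rightarrow> 'k::field"
  assumes "infinite (UNIV :: 'k set)" "\<And>t. (\<Sum>k\<le>n. a k * t ^ k) = 0" "k \<le> n"
  shows "a k = 0"
proof -
  define p where "p = (\<Sum>k\<le>n. monom (a k) k)"
  have "poly p t = 0" for t using assms(2) by (simp add: p_def poly_sum poly_monom)
  then have "p = 0" using assms(1) poly_roots_finite[of p] by auto
  moreover have "coeff p k = a k" using assms(3) by (simp add: p_def coeff_sum)
  ultimately show ?thesis by simp
qed

text \<open>
  The induction treats one variable at a time: for fixed values of the others, a vanishing sum is a
  polynomial in this variable with infinitely many roots, so that its coefficients, which are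
  polynomials in the other variables, vanish as functions.
\<close>
lemma polynomial_coefficients_zero:
  fixes c :: "('i \<Rightarrow> nat) \<Rightarrow> 'k::field"
  assumes inf: "infinite (UNIV :: 'k set)"
    and "finite A" "\<And>y. (\<Sum>e\<in>exponents A n. c e * monomial A e y) = 0" "e \<in> exponents A n"
  shows "c e = 0"
  using assms(2-)
proof (induction A arbitrary: c e rule: finite_induct)
  case empty
  then show ?case by (simp add: exponents_def monomial_def)
next
  case (insert a A)
  have exps: "exponents (insert a A) n = (\<lambda>(k, e). e(a := k)) ` ({..n} \<times> exponents A n)"
    by (simp add: exponents_def PiE_insert_eq)
  have inj: "inj_on (\<lambda>(k, e). e(a := k)) ({..n} \<times> exponents A n)"
    unfolding exponents_def using inj_combinator[OF insert.hyps(2), of "\<lambda>i. {..n}"] by simp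
  have mon: "monomial (insert a A) (e(a := k)) y = y a ^ k * monomial A e y" for e k and y :: "'i \<Rightarrow> 'k"
  proof -
    have "(\<Prod>i\<in>A. y i ^ (e(a := k)) i) = (\<Prod>i\<in>A. y i ^ e i)"
      using insert.hyps by (intro prod.cong) auto
    then show ?thesis using insert.hyps by (simp add: monomial_def)
  qed
  have mon': "monomial A e (y(a := t)) = monomial A e y" for e t and y :: "'i \<Rightarrow> 'k"
    unfolding monomial_def using insert.hyps by (intro prod.cong) auto
  have "(\<Sum>e\<in>exponents A n. c (e(a := k)) * monomial A e y) = 0" if "k \<le> n" for k y
  proof -
    have "(\<Sum>k\<le>n. (\<Sum>e\<in>exponents A n. c (e(a := k)) * monomial A e y) * t ^ k) = 0" for t
    proof -
      have "0 = (\<Sum>e\<in>exponents (insert a A) n. c e * monomial (insert a A) e (y(a := t)))"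
        using insert.prems(1) by simp
      also have "\<dots> = (\<Sum>(k, e)\<in>{..n} \<times> exponents A n. c (e(a := k)) * monomial A e y * t ^ k)"
        unfolding exps sum.reindex[OF inj]
        by (rule sum.cong) (auto simp: mon mon' mult_ac)
      also have "\<dots> = (\<Sum>k\<le>n. (\<Sum>e\<in>exponents A n. c (e(a := k)) * monomial A e y) * t ^ k)"
        by (simp add: sum.cartesian_product[symmetric] sum_distrib_right)
      finally show ?thesis by simp
    qed
    then show ?thesis by (rule univariate_coefficients_zero[OF inf _ that])
  qed
  note zero = insert.IH[OF this]
  obtain k e' where "k \<le> n" "e' \<in> exponents A n" "e = e'(a := k)"
    using insert.prems(2) unfolding exps by auto
  then show ?case using zero by blast
qed

lemma nonzero_polynomial_line_open:
  fixes c :: "('i \<Rightarrow> nat) \<Rightarrow> 'k::field"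
  shows "line_open {f. (\<Sum>e\<in>E. c e * monomial A e f) \<noteq> 0}"
  unfolding line_open_def
proof (intro allI impI)
  fix f g :: "'i \<Rightarrow> 'k" and s
  define p where "p = (\<Sum>e\<in>E. Polynomial.smult (c e) (\<Prod>i\<in>A. [: f i, g i - f i :] ^ e i))"
  have p: "poly p t = (\<Sum>e\<in>E. c e * monomial A e (segment f g t))" for t
    by (simp add: p_def monomial_def segment_def poly_sum poly_prod)
  assume "segment f g s \<in> {f. (\<Sum>e\<in>E. c e * monomial A e f) \<noteq> 0}"
  then have "poly p s \<noteq> 0" by (simp add: p)
  then have "finite {t. poly p t = 0}" using poly_roots_finite[of p] by fastforce
  then show "finite {t. segment f g t \<notin> {f. (\<Sum>e\<in>E. c e * monomial A e f) \<noteq> 0}}"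
    by (simp add: p)
qed

text \<open>
  Counting monomials replaces dimension theory. The monomials in the target with exponents up to \<open>k\<close> number about
  \<open>k\<close> to the power \<open>card A\<close>; pulled back, they lie in a space of dimension about \<open>k\<close> to the power
  \<open>card B\<close>, up to a constant factor. For large \<open>k\<close> a nontrivial combination pulls back to zero, so
  the image lies in a hypersurface. This argument is independent of the characteristic.
\<close>
lemma generically_not_in_image:
  fixes F :: "('j \<Rightarrow> 'k::field) \<Rightarrow> 'i \<Rightarrow> 'k"
  assumes inf: "infinite (UNIV :: 'k set)"
    and "finite A" "finite B" and card: "card B < card A"
    and F: "\<And>a. a \<in> A \<Longrightarrow> poly_fun B n (\<lambda>y. F y a)"
  shows "generically (\<lambda>f. \<nexists>y. \<forall>a\<in>A. f a = F y a)"
proof -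
  \<comment> \<open>pulled back monomials have exponents up to \<open>card A * (k * n)\<close>, at most \<open>C * Suc k\<close> values per\<close>
  \<comment> \<open>variable; the choice of \<open>k\<close> lets one extra factor \<open>Suc k\<close> absorb the constant \<open>C ^ card B\<close>\<close>
  define C where "C = Suc (card A * n)"
  define k where "k = C ^ card B"
  have "Suc (card A * (k * n)) ^ card B \<le> (C * Suc k) ^ card B"
    by (rule power_mono) (auto simp: C_def algebra_simps)
  also have "\<dots> = k * Suc k ^ card B" by (simp only: k_def power_mult_distrib)
  also have "\<dots> < Suc k * Suc k ^ card B" by simp
  also have "\<dots> = Suc k ^ Suc (card B)" by simp
  also have "\<dots> \<le> Suc k ^ card A" using card by (intro power_increasing) auto
  finally have count: "Suc (card A * (k * n)) ^ card B < card (exponents A k)"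
    using assms(2) by (simp add: card_exponents)
  have "poly_fun B (card A * (k * n)) (\<lambda>y. monomial A e (F y))" if "e \<in> exponents A k" for e
    unfolding monomial_def
  proof (rule poly_fun_prod[OF assms(2)])
    fix a assume a: "a \<in> A"
    have "e a * n \<le> k * n" using that a by (auto simp: exponents_def intro!: mult_le_mono1)
    then show "poly_fun B (k * n) (\<lambda>y. F y a ^ e a)"
      using poly_fun_mono[OF poly_fun_power[OF F[OF a]]] by blast
  qed
  then have "\<exists>c. (\<exists>e\<in>exponents A k. c e \<noteq> 0) \<and>
      (\<forall>y. (\<Sum>e\<in>exponents A k. c e * monomial A e (F y)) = 0)"
    using count by (intro poly_fun_dependence[OF assms(3) finite_exponents[OF assms(2)]])
  then obtain c where c: "\<exists>e\<in>exponents A k. c e \<noteq> 0"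
    and vanish: "\<And>y. (\<Sum>e\<in>exponents A k. c e * monomial A e (F y)) = 0" by blast
  define T where "T = {f. (\<Sum>e\<in>exponents A k. c e * monomial A e f) \<noteq> 0}"
  have "T \<noteq> {}"
  proof
    assume "T = {}"
    then have "(\<Sum>e\<in>exponents A k. c e * monomial A e f) = 0" for f by (auto simp: T_def)
    then show False using c polynomial_coefficients_zero[OF inf assms(2)] by blast
  qed
  moreover have "\<nexists>y. \<forall>a\<in>A. f a = F y a" if "f \<in> T" for f
  proof
    assume "\<exists>y. \<forall>a\<in>A. f a = F y a"
    then obtain y where "\<forall>a\<in>A. f a = F y a" by blast
    then have "monomial A e f = monomial A e (F y)" for e
      unfolding monomial_def by (intro prod.cong) auto
    then show False using that vanish[of y] by (simp add: T_def)
  qed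
  ultimately show ?thesis
    unfolding generically_def T_def using nonzero_polynomial_line_open by blast
qed

section \<open>Coordinates on a subspace\<close>

lemma vec_subspaceD:
  assumes "VectorSpace.subspace class_ring U (module_vec TYPE('k::field) n)"
  shows "U \<subseteq> carrier_vec n" "0\<^sub>v n \<in> U"
    "\<And>x y. x \<in> U \<Longrightarrow> y \<in> U \<Longrightarrow> x + y \<in> U" "\<And>c x. x \<in> U \<Longrightarrow> c \<cdot>\<^sub>v x \<in> U"
    "\<And>x. x \<in> U \<Longrightarrow> dim_vec x = n"
  using assms by (auto simp: VectorSpace.subspace_def LinearCombinations.submodule_def module_vec_simps)

text \<open>
  \<open>U\<close> is a graph over the coordinates in \<open>S\<close>: a vector of \<open>U\<close> is determined by its entries in \<open>S\<close>,
  which are arbitrary, and the columns of \<open>N\<close> form the basis of \<open>U\<close> dual to these entries. The pair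
  \<open>(S, N)\<close> is a point in one of the standard affine charts of the Grassmannian.
\<close>
definition coordinatized :: "nat \<Rightarrow> nat set \<Rightarrow> (nat \<Rightarrow> nat \<Rightarrow> 'k::field) \<Rightarrow> 'k vec set \<Rightarrow> bool" where
  "coordinatized n S N U \<longleftrightarrow> S \<subseteq> {..<n} \<and> (\<forall>s\<in>S. \<forall>l\<in>S. N s l = (if s = l then 1 else 0)) \<and>
     U = {x \<in> carrier_vec n. \<forall>p<n. x $ p = (\<Sum>s\<in>S. N p s * x $ s)}"

lemma coordinatized_finite: "coordinatized n S N U \<Longrightarrow> finite S"
  unfolding coordinatized_def using finite_subset by blast

text \<open>
  Every subspace lies in some chart: take \<open>S\<close> of least size such that the entries in \<open>S\<close> determine
  the vectors of \<open>U\<close>. By minimality, for each \<open>s\<close> in \<open>S\<close> some vector of \<open>U\<close> vanishes on all of \<open>S\<close>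
  except at \<open>s\<close>, and these vectors, rescaled, are the columns of \<open>N\<close>.
\<close>
lemma subspace_coordinatized:
  fixes U :: "'k::field vec set"
  assumes U: "VectorSpace.subspace class_ring U (module_vec TYPE('k) n)"
  shows "\<exists>S N. coordinatized n S N U"
proof -
  define determining where "determining S \<longleftrightarrow> S \<subseteq> {..<n} \<and> (\<forall>x\<in>U. (\<forall>s\<in>S. x $ s = 0) \<longrightarrow> x = 0\<^sub>v n)" for S
  note sub = vec_subspaceD[OF U]
  have "determining {..<n}"
    unfolding determining_def using sub(1) by (auto intro!: eq_vecI)
  then obtain S where S: "determining S" and min: "\<And>S'. determining S' \<Longrightarrow> card S \<le> card S'"
    using ex_has_least_nat[of determining "{..<n}" card] by blast
  have Sn: "S \<subseteq> {..<n}" and fin: "finite S"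
    using S finite_subset unfolding determining_def by blast+
  have "\<exists>u\<in>U. \<forall>l\<in>S. u $ l = (if l = s then 1 else 0)" if s: "s \<in> S" for s
  proof -
    have "\<not> determining (S - {s})"
      using min[of "S - {s}"] s fin by (metis card_Diff1_less leD)
    then obtain x where x: "x \<in> U" "\<forall>l\<in>S - {s}. x $ l = 0" "x \<noteq> 0\<^sub>v n"
      unfolding determining_def using Sn by blast
    have "x $ s \<noteq> 0" using S x unfolding determining_def by (metis Diff_iff singletonD)
    moreover have "dim_vec x = n" using x(1) sub(1) by auto
    ultimately have "\<forall>l\<in>S. ((1 / x $ s) \<cdot>\<^sub>v x) $ l = (if l = s then 1 else 0)"
      using x(2) s Sn by auto
    then show ?thesis using sub(4)[OF x(1)] by blast
  qed
  then obtain u where u: "\<And>s. s \<in> S \<Longrightarrow> u s \<in> U" "\<And>s l. s \<in> S \<Longrightarrow> l \<in> S \<Longrightarrow> u s $ l = (if l = s then 1 else 0)"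
    by metis
  define comb where "comb T x = vec n (\<lambda>p. \<Sum>s\<in>T. u s $ p * x $ s)" for T and x :: "'k vec"
  have comb: "comb T x \<in> U" if "T \<subseteq> S" for T x
    using finite_subset[OF that fin] that
  proof induction
    case empty
    have "comb {} x = 0\<^sub>v n" by (auto simp: comb_def)
    then show ?case using sub(2) by simp
  next
    case (insert s T)
    have ds: "dim_vec (u s) = n" using u(1) insert sub(5) by auto
    have "comb (insert s T) x = x $ s \<cdot>\<^sub>v u s + comb T x"
      by (rule eq_vecI) (use insert ds in \<open>auto simp: comb_def mult.commute\<close>)
    then show ?case using insert u(1) sub(3,4) by simp
  qed
  define N where "N = (\<lambda>p s. u s $ p)"
  have delta: "\<forall>s\<in>S. \<forall>l\<in>S. N s l = (if s = l then 1 else 0)" using u(2) by (simp add: N_def)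
  have "x \<in> U \<longleftrightarrow> x \<in> carrier_vec n \<and> (\<forall>p<n. x $ p = (\<Sum>s\<in>S. N p s * x $ s))" for x
  proof
    assume x: "x \<in> U"
    have xn: "x \<in> carrier_vec n" using x sub(1) by blast
    let ?y = "x + (-1) \<cdot>\<^sub>v comb S x"
    have y: "?y \<in> U" using sub(3,4) x comb by blast
    have yp: "?y $ p = x $ p - (\<Sum>s\<in>S. N p s * x $ s)" if "p < n" for p
      using that xn by (simp add: comb_def N_def)
    have "?y $ l = 0" if l: "l \<in> S" for l
    proof -
      have "(\<Sum>s\<in>S. N l s * x $ s) = (\<Sum>s\<in>S. if s = l then x $ s else 0)"
        using delta l by (intro sum.cong) auto
      also have "\<dots> = x $ l" using l fin by simp
      finally show ?thesis using yp[of l] l Sn by auto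
    qed
    then have "?y = 0\<^sub>v n" using S y unfolding determining_def by blast
    then have "?y $ p = 0" if "p < n" for p using that by simp
    then show "x \<in> carrier_vec n \<and> (\<forall>p<n. x $ p = (\<Sum>s\<in>S. N p s * x $ s))"
      using xn yp by simp
  next
    assume x: "x \<in> carrier_vec n \<and> (\<forall>p<n. x $ p = (\<Sum>s\<in>S. N p s * x $ s))"
    then have "x = comb S x" by (intro eq_vecI) (auto simp: comb_def N_def)
    then show "x \<in> U" using comb by (metis order_refl)
  qed
  then show ?thesis
    unfolding coordinatized_def using Sn delta by (intro exI[of _ S] exI[of _ N]) auto
qed

lemma coordinatized_full_iff:
  assumes "coordinatized n S N U"
  shows "U = carrier_vec n \<longleftrightarrow> S = {..<n}"
proof
  assume U: "U = carrier_vec n"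
  show "S = {..<n}"
  proof (rule ccontr)
    assume "S \<noteq> {..<n}"
    then obtain p where p: "p < n" "p \<notin> S" using assms unfolding coordinatized_def by auto
    have "unit_vec n p \<in> U" using U by simp
    then have "unit_vec n p $ p = (\<Sum>s\<in>S. N p s * unit_vec n p $ s)"
      using p assms unfolding coordinatized_def by blast
    also have "\<dots> = 0"
    proof (intro sum.neutral ballI)
      fix s assume "s \<in> S"
      then have "s < n" "s \<noteq> p" using p assms unfolding coordinatized_def by auto
      then show "N p s * unit_vec n p $ s = 0" using p by simp
    qed
    finally show False using p by simp
  qed
next
  assume S: "S = {..<n}"
  have "x $ p = (\<Sum>s\<in>S. N p s * x $ s)" if "p < n" for x p
  proof -
    have "(\<Sum>s\<in>S. N p s * x $ s) = (\<Sum>s\<in>S. if s = p then x $ s else 0)"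
      using assms that S unfolding coordinatized_def by (intro sum.cong) auto
    then show ?thesis using that S by simp
  qed
  then show "U = carrier_vec n" using assms unfolding coordinatized_def by auto
qed

lemma coordinatized_column:
  assumes c: "coordinatized n S N U" and s: "s \<in> S"
  shows "vec n (\<lambda>p. N p s) \<in> U"
proof -
  have "(\<Sum>l\<in>S. N p l * vec n (\<lambda>p. N p s) $ l) = N p s" if "p < n" for p
  proof -
    have "(\<Sum>l\<in>S. N p l * vec n (\<lambda>p. N p s) $ l) = (\<Sum>l\<in>S. if l = s then N p l else 0)"
      using c s unfolding coordinatized_def by (intro sum.cong) auto
    then show ?thesis using coordinatized_finite[OF c] s by simp
  qed
  then show ?thesis using c unfolding coordinatized_def by auto
qed

lemma coordinatized_zero_iff:
  assumes c: "coordinatized n S N U"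
  shows "U = {0\<^sub>v n} \<longleftrightarrow> S = {}"
proof
  assume U: "U = {0\<^sub>v n}"
  show "S = {}"
  proof (rule ccontr)
    assume "S \<noteq> {}"
    then obtain s where s: "s \<in> S" by blast
    then have "vec n (\<lambda>p. N p s) = 0\<^sub>v n" using coordinatized_column[OF c] U by blast
    moreover have "s < n" "N s s = 1" using s c unfolding coordinatized_def by auto
    ultimately have "N s s = 0" by (metis index_vec index_zero_vec(1))
    then show False using \<open>N s s = 1\<close> by simp
  qed
next
  assume "S = {}"
  then show "U = {0\<^sub>v n}" using c unfolding coordinatized_def by (auto intro!: eq_vecI)
qed

text \<open>
  The columns of \<open>N\<close> give an isomorphism from a coordinate space onto \<open>U\<close>, with inverse the
  restriction to the entries in \<open>S\<close>.
\<close>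
lemma coordinatized_dim:
  fixes U :: "'k::field vec set"
  assumes U: "VectorSpace.subspace class_ring U (module_vec TYPE('k) n)" and c: "coordinatized n S N U"
  shows "vectorspace.dim class_ring (module_vec TYPE('k) n\<lparr>carrier := U\<rparr>) = card S"
proof -
  note fin = coordinatized_finite[OF c]
  define k where "k = card S"
  obtain e where e: "bij_betw e {..<k} S"
    using ex_bij_betw_nat_finite[OF fin] by (auto simp: k_def atLeast0LessThan)
  let ?U = "module_vec TYPE('k) n\<lparr>carrier := U\<rparr>"
  interpret Kn: vec_space "TYPE('k)" n .
  interpret Kk: vec_space "TYPE('k)" k .
  interpret UU: vectorspace class_ring ?U
    using U by (rule Kn.subspace_is_vs)
  define T where "T y = vec n (\<lambda>p. \<Sum>i<k. N p (e i) * y $ i)" for y :: "'k vec"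
  have sum_S: "(\<Sum>s\<in>S. g s) = (\<Sum>i<k. g (e i))" for g :: "nat \<Rightarrow> 'k"
    using sum.reindex_bij_betw[OF e] by metis
  have eS: "e i \<in> S" "e i < n" if "i < k" for i
    using that e c unfolding bij_betw_def coordinatized_def by auto
  have T_e: "T y $ e i = y $ i" if "i < k" for y i
  proof -
    have "T y $ e i = (\<Sum>l<k. if l = i then y $ l else 0)"
      unfolding T_def index_vec[OF eS(2)[OF that]]
    proof (intro sum.cong refl)
      fix l assume l: "l \<in> {..<k}"
      have "e i = e l \<longleftrightarrow> i = l" using e l that by (auto simp: bij_betw_def inj_on_def)
      then show "N (e i) (e l) * y $ l = (if l = i then y $ l else 0)"
        using c eS l that unfolding coordinatized_def by auto
    qed
    then show ?thesis using that by simp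
  qed
  have TU: "T y \<in> U" for y
  proof -
    have "T y $ p = (\<Sum>s\<in>S. N p s * T y $ s)" if "p < n" for p
      unfolding sum_S using that T_e by (simp add: T_def)
    then show ?thesis using c unfolding coordinatized_def by (auto simp: T_def)
  qed
  have T_add: "T (x + y) = T x + T y" if "x \<in> carrier_vec k" "y \<in> carrier_vec k" for x y
    using that by (intro eq_vecI) (auto simp: T_def sum.distrib distrib_left)
  have T_smult: "T (c \<cdot>\<^sub>v x) = c \<cdot>\<^sub>v T x" if "x \<in> carrier_vec k" for c x
    using that by (intro eq_vecI) (auto simp: T_def sum_distrib_left mult_ac)
  have "linear_map class_ring Kk.V ?U T"
  proof
    show "T \<in> LinearCombinations.module_hom class_ring Kk.V ?U"
      unfolding LinearCombinations.module_hom_def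
      using TU T_add T_smult by (auto simp: module_vec_simps)
  qed
  then interpret T: linear_map class_ring Kk.V ?U T .
  have "Kk.dim = UU.dim"
  proof (rule T.dim_eq)
    show "inj_on T (carrier Kk.V)"
    proof (rule inj_onI)
      fix x y assume "x \<in> carrier Kk.V" "y \<in> carrier Kk.V" "T x = T y"
      then show "x = y" using T_e by (intro eq_vecI) (auto simp: module_vec_simps, metis)
    qed
    show "T ` carrier Kk.V = carrier ?U"
    proof
      show "T ` carrier Kk.V \<subseteq> carrier ?U" using TU by auto
      show "carrier ?U \<subseteq> T ` carrier Kk.V"
      proof
        fix x assume "x \<in> carrier ?U"
        then have x: "x \<in> carrier_vec n" "\<forall>p<n. x $ p = (\<Sum>i<k. N p (e i) * x $ e i)"
          using c unfolding coordinatized_def sum_S by auto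
        have "x = T (vec k (\<lambda>i. x $ e i))"
          using x by (intro eq_vecI) (auto simp: T_def)
        then show "x \<in> T ` carrier Kk.V" by (simp add: module_vec_simps)
      qed
    qed
  qed simp
  then show ?thesis using Kk.dim_is_n by (simp add: k_def)
qed

section \<open>Subrepresentations of a generic representation\<close>

text \<open>
  In coordinates, a representation is a point \<open>f\<close> of affine space: \<open>f (a, p, q)\<close> is the entry in row \<open>p\<close>
  and column \<open>q\<close> of the matrix of the arrow \<open>a\<close>. A frame chooses a chart and a point in it at every
  vertex, hence a family of subspaces with dimensions \<open>card (S v)\<close>.
\<close>
definition frame :: "('v, 'a) pre_digraph \<Rightarrow> ('v \<Rightarrow> nat) \<Rightarrow> ('v \<Rightarrow> nat set) \<Rightarrow>
    ('v \<Rightarrow> nat \<Rightarrow> nat \<Rightarrow> 'k::field) \<Rightarrow> bool" where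
  "frame Q d S N \<longleftrightarrow> (\<forall>v\<in>verts Q. S v \<subseteq> {..<d v} \<and> (\<forall>s\<in>S v. \<forall>l\<in>S v. N v s l = (if s = l then 1 else 0)))"

text \<open>
  The subspaces of the frame form a subrepresentation. Since the columns of the frame are bases,
  invariance is a condition on their images only.
\<close>
definition preserves :: "('v, 'a) pre_digraph \<Rightarrow> ('v \<Rightarrow> nat) \<Rightarrow> ('v \<Rightarrow> nat set) \<Rightarrow>
    ('v \<Rightarrow> nat \<Rightarrow> nat \<Rightarrow> 'k::field) \<Rightarrow> ('a \<times> nat \<times> nat \<Rightarrow> 'k) \<Rightarrow> bool" where
  "preserves Q d S N f \<longleftrightarrow> (\<forall>a\<in>arcs Q. \<forall>p<d (head Q a). \<forall>s\<in>S (tail Q a).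
     (\<Sum>q<d (tail Q a). f (a, p, q) * N (tail Q a) q s) =
     (\<Sum>l\<in>S (head Q a). N (head Q a) p l * (\<Sum>q<d (tail Q a). f (a, l, q) * N (tail Q a) q s)))"

lemma frame_sum_left:
  assumes "frame Q d S N" "v \<in> verts Q" "p \<in> S v"
  shows "(\<Sum>s\<in>S v. N v p s * g s) = g p"
proof -
  have "finite (S v)" using assms unfolding frame_def by (metis finite_lessThan finite_subset)
  moreover have "(\<Sum>s\<in>S v. N v p s * g s) = (\<Sum>s\<in>S v. if s = p then g s else 0)"
    using assms unfolding frame_def by (intro sum.cong) auto
  ultimately show ?thesis using assms by simp
qed

lemma frame_sum_right:
  assumes "frame Q d S N" "v \<in> verts Q" "l \<in> S v"
  shows "(\<Sum>q<d v. g q * N v q l) = g l + (\<Sum>q\<in>{..<d v} - S v. g q * N v q l)"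
proof -
  have S: "S v \<subseteq> {..<d v}" using assms unfolding frame_def by blast
  then have "finite (S v)" by (metis finite_lessThan finite_subset)
  moreover have "(\<Sum>q\<in>S v. g q * N v q l) = (\<Sum>q\<in>S v. if q = l then g q else 0)"
    using assms unfolding frame_def by (intro sum.cong) auto
  ultimately have "(\<Sum>q\<in>S v. g q * N v q l) = g l" using assms by simp
  then show ?thesis using sum.subset_diff[OF S, of "\<lambda>q. g q * N v q l"] by (simp add: add.commute)
qed

text \<open>
  Put \<open>e v = card (S v)\<close>; the last hypothesis is \<open>\<langle>e, d - e\<rangle> < 0\<close> for the Euler form.
  Representations with a subrepresentation in the chart \<open>S\<close> are parametrized by the matrix \<open>N\<close> and by
  those entries of \<open>f\<close> that are not in a row outside \<open>S (head a)\<close> and a column in \<open>S (tail a)\<close>, because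
  invariance expresses the latter as polynomials in the former. The number of parameters
  minus the number of entries of \<open>f\<close> is \<open>\<langle>e, d - e\<rangle>\<close>, so there are too few parameters to reach the
  generic representation.
\<close>
lemma generically_no_subrepresentation:
  fixes Q :: "('v, 'a) pre_digraph" and d :: "'v \<Rightarrow> nat"
  assumes Q: "fin_digraph Q" and inf: "infinite (UNIV :: 'k::field set)"
    and S: "\<And>v. v \<in> verts Q \<Longrightarrow> S v \<subseteq> {..<d v}"
    and neg: "(\<Sum>v\<in>verts Q. card (S v) * (d v - card (S v))) <
      (\<Sum>a\<in>arcs Q. card (S (tail Q a)) * (d (head Q a) - card (S (head Q a))))"
  shows "generically (\<lambda>f :: 'a \<times> nat \<times> nat \<Rightarrow> 'k. \<nexists>N. frame Q d S N \<and> preserves Q d S N f)"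
proof -
  interpret Q: fin_digraph Q by (rule Q)
  define t where "t = tail Q"
  define h where "h = head Q"
  have th: "t a \<in> verts Q" "h a \<in> verts Q" if "a \<in> arcs Q" for a
    using that by (auto simp: t_def h_def)
  have finS: "finite (S v)" if "v \<in> verts Q" for v
    using S[OF that] by (metis finite_lessThan finite_subset)
  have card_co: "card ({..<d v} - S v) = d v - card (S v)" if "v \<in> verts Q" for v
    using S[OF that] finS[OF that] by (simp add: card_Diff_subset)
  define A where "A = (SIGMA a:arcs Q. {..<d (h a)} \<times> {..<d (t a)})"
  define R where "R = (SIGMA a:arcs Q. ({..<d (h a)} - S (h a)) \<times> S (t a))"
  define Z where "Z = (SIGMA v:verts Q. ({..<d v} - S v) \<times> S v)"
  define B where "B = Inl ` Z \<union> Inr ` (A - R)"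
  have finA: "finite A" by (simp add: A_def)
  have RA: "R \<subseteq> A" using S th by (fastforce simp: R_def A_def)
  have finZ: "finite Z" using finS by (simp add: Z_def)
  have finB: "finite B" using finA finZ by (simp add: B_def)
  have "card R = (\<Sum>a\<in>arcs Q. card (S (t a)) * (d (h a) - card (S (h a))))"
    using th finS by (simp add: R_def card_cartesian_product card_co mult.commute)
  moreover have "card Z = (\<Sum>v\<in>verts Q. card (S v) * (d v - card (S v)))"
    using finS by (simp add: Z_def card_cartesian_product card_co mult.commute)
  moreover have "card B = card Z + card (A - R)"
    unfolding B_def using finA finZ
    by (subst card_Un_disjoint) (auto simp: card_image)
  moreover have "card (A - R) = card A - card R" "card R \<le> card A"
    using RA finA by (auto simp: card_Diff_subset finite_subset card_mono)
  ultimately have card: "card B < card A" using neg by (simp add: t_def h_def)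
  define co where "co a = {..<d (t a)} - S (t a)" for a
  \<comment> \<open>solve the invariance equation in row \<open>p\<close> and column \<open>q\<close> for its term \<open>f (a, p, q)\<close>\<close>
  define F :: "('v \<times> nat \<times> nat + 'a \<times> nat \<times> nat \<Rightarrow> 'k) \<Rightarrow> 'a \<times> nat \<times> nat \<Rightarrow> 'k" where
    "F y = (\<lambda>(a, p, q). if (a, p, q) \<in> R
      then - (\<Sum>l\<in>co a. y (Inr (a, p, l)) * y (Inl (t a, l, q))) +
        (\<Sum>s\<in>S (h a). y (Inl (h a, p, s)) *
          (y (Inr (a, s, q)) + (\<Sum>l\<in>co a. y (Inr (a, s, l)) * y (Inl (t a, l, q)))))
      else y (Inr (a, p, q)))" for y
  have "poly_fun B 3 (\<lambda>y. F y b)" if b: "b \<in> A" for b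
  proof (cases "b \<in> R")
    case False
    then have "poly_fun B 3 (\<lambda>y. y (Inr b))"
      using b finB by (intro poly_fun_coordinate) (auto simp: B_def)
    moreover have "(\<lambda>y. F y b) = (\<lambda>y. y (Inr b))"
      using False by (auto simp: F_def split: prod.splits)
    ultimately show ?thesis by simp
  next
    case True
    obtain a p q where bq: "b = (a, p, q)" by (cases b)
    have a: "a \<in> arcs Q" and p: "p < d (h a)" "p \<notin> S (h a)" and q: "q \<in> S (t a)"
      using True by (auto simp: R_def bq)
    have Sa: "S (t a) \<subseteq> {..<d (t a)}" "S (h a) \<subseteq> {..<d (h a)}" using S th a by auto
    have x1: "poly_fun B 1 (\<lambda>y. y (Inl (h a, p, s)))" if "s \<in> S (h a)" for s
      using that p a th finB by (intro poly_fun_coordinate) (auto simp: B_def Z_def)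
    have x2: "poly_fun B 1 (\<lambda>y. y (Inl (t a, l, q)))" if "l \<in> co a" for l
      using that q a th finB by (intro poly_fun_coordinate) (auto simp: B_def Z_def co_def)
    have x3: "poly_fun B 1 (\<lambda>y. y (Inr (a, p', l)))" if "l \<in> co a" "p' < d (h a)" for p' l
      using that a finB by (intro poly_fun_coordinate) (auto simp: B_def A_def R_def co_def)
    have x4: "poly_fun B 2 (\<lambda>y. y (Inr (a, s, q)))" if "s \<in> S (h a)" for s
      using that a q finB Sa by (intro poly_fun_coordinate) (auto simp: B_def A_def R_def)
    have finco: "finite (co a)" by (simp add: co_def)
    have x5: "poly_fun B 2 (\<lambda>y. \<Sum>l\<in>co a. y (Inr (a, p', l)) * y (Inl (t a, l, q)))"
      if "p' < d (h a)" for p'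
    proof (rule poly_fun_sum[OF finco])
      fix l assume l: "l \<in> co a"
      show "poly_fun B 2 (\<lambda>y. y (Inr (a, p', l)) * y (Inl (t a, l, q)))"
        using poly_fun_mult[OF x3[OF l that] x2[OF l]] by (simp add: numeral_2_eq_2)
    qed
    have x6: "poly_fun B 3 (\<lambda>y. \<Sum>s\<in>S (h a). y (Inl (h a, p, s)) *
          (y (Inr (a, s, q)) + (\<Sum>l\<in>co a. y (Inr (a, s, l)) * y (Inl (t a, l, q)))))"
    proof (rule poly_fun_sum[OF finS])
      show "h a \<in> verts Q" using th a by blast
      fix s assume s: "s \<in> S (h a)"
      have "poly_fun B (1 + 2) (\<lambda>y. y (Inl (h a, p, s)) *
          (y (Inr (a, s, q)) + (\<Sum>l\<in>co a. y (Inr (a, s, l)) * y (Inl (t a, l, q)))))"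
        using s Sa by (intro poly_fun_mult[OF x1] poly_fun_add x4 x5) auto
      then show "poly_fun B 3 (\<lambda>y. y (Inl (h a, p, s)) *
          (y (Inr (a, s, q)) + (\<Sum>l\<in>co a. y (Inr (a, s, l)) * y (Inl (t a, l, q)))))"
        by (rule poly_fun_mono) simp
    qed
    have x7: "poly_fun B 3 (\<lambda>y. - (\<Sum>l\<in>co a. y (Inr (a, p, l)) * y (Inl (t a, l, q))))"
      by (rule poly_fun_mono[OF poly_fun_uminus[OF x5[OF p(1)]]]) simp
    show ?thesis using poly_fun_add[OF x7 x6] True by (simp add: F_def bq)
  qed
  then have gen: "generically (\<lambda>f :: 'a \<times> nat \<times> nat \<Rightarrow> 'k. \<nexists>y. \<forall>b\<in>A. f b = F y b)"
    by (rule generically_not_in_image[OF inf finA finB card])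
  have "\<exists>y. \<forall>b\<in>A. f b = F y b"
    if N: "frame Q d S N" and pr: "preserves Q d S N f" for f :: "'a \<times> nat \<times> nat \<Rightarrow> 'k" and N
  proof (intro exI ballI)
    fix b assume b: "b \<in> A"
    let ?y = "\<lambda>i. case i of Inl (v, l, s) \<Rightarrow> N v l s | Inr c \<Rightarrow> f c"
    obtain a p q where bq: "b = (a, p, q)" by (cases b)
    show "f b = F ?y b"
    proof (cases "b \<in> R")
      case False
      then show ?thesis by (simp add: F_def bq)
    next
      case True
      then have a: "a \<in> arcs Q" and p: "p < d (h a)" "p \<notin> S (h a)" and q: "q \<in> S (t a)"
        by (auto simp: R_def bq)
      have "(\<Sum>l<d (t a). f (a, p', l) * N (t a) l q) =
          f (a, p', q) + (\<Sum>l\<in>co a. f (a, p', l) * N (t a) l q)" for p'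
        unfolding co_def using frame_sum_right[OF N th(1)[OF a] q] .
      moreover have "(\<Sum>l<d (t a). f (a, p, l) * N (t a) l q) =
          (\<Sum>s\<in>S (h a). N (h a) p s * (\<Sum>l<d (t a). f (a, s, l) * N (t a) l q))"
        using pr a p(1) q unfolding preserves_def t_def h_def by blast
      ultimately show ?thesis using True by (simp add: F_def bq algebra_simps)
    qed
  qed
  then show ?thesis by (intro generically_mono[OF gen]) blast
qed

definition is_endo :: "('v, 'a) pre_digraph \<Rightarrow> ('v \<Rightarrow> nat) \<Rightarrow> ('a \<times> nat \<times> nat \<Rightarrow> 'k::field) \<Rightarrow>
    ('v \<times> nat \<times> nat \<Rightarrow> 'k) \<Rightarrow> bool" where
  "is_endo Q d f x \<longleftrightarrow> (\<forall>a\<in>arcs Q. \<forall>p<d (head Q a). \<forall>q<d (tail Q a).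
     (\<Sum>l<d (tail Q a). f (a, p, l) * x (tail Q a, l, q)) =
     (\<Sum>l<d (head Q a). x (head Q a, p, l) * f (a, l, q)))"

definition brick :: "('v, 'a) pre_digraph \<Rightarrow> ('v \<Rightarrow> nat) \<Rightarrow> ('a \<times> nat \<times> nat \<Rightarrow> 'k::field) \<Rightarrow> bool" where
  "brick Q d f \<longleftrightarrow> (\<exists>v\<in>verts Q. d v \<noteq> 0) \<and> (\<forall>x. is_endo Q d f x \<longrightarrow>
     (\<exists>c. \<forall>v\<in>verts Q. \<forall>p<d v. \<forall>q<d v. x (v, p, q) = (if p = q then c else 0)))"

text \<open>
  In terms of the Euler form: \<open>\<langle>d - e, e\<rangle> < 0\<close> for a subrepresentation of dimension \<open>e\<close> of a brick. In
  homological language, \<open>\<langle>d - e, e\<rangle>\<close> is the dimension of the homomorphisms from the quotient to the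
  subrepresentation minus that of the extensions. If it is not negative, then either there is a
  nonzero homomorphism, which gives a nilpotent endomorphism, or there is no extension, and a
  projection onto the subrepresentation commutes with the arrows. The proof treats both cases at
  once: it looks for endomorphisms with image in the subrepresentation that act on it as a scalar
  \<open>c\<close>. Such a family of linear maps is determined by \<open>c\<close> and its values on complements of the
  subspaces. That it commutes with the arrows has to be checked only on the complement at the tail,
  and there the two sides to be compared lie in the subspace at the head.
  Because of the extra unknown \<open>c\<close>, unknowns outnumber equations if \<open>\<langle>d - e, e\<rangle>\<close> is not negative.
\<close>
lemma brick_subrepresentation:
  fixes Q :: "('v, 'a) pre_digraph" and d :: "'v \<Rightarrow> nat" and f :: "'a \<times> nat \<times> nat \<Rightarrow> 'k::field"
  assumes Q: "fin_digraph Q" and f: "brick Q d f" and N: "frame Q d S N" and pr: "preserves Q d S N f"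
    and nonzero: "\<exists>v\<in>verts Q. S v \<noteq> {}" and proper: "\<exists>v\<in>verts Q. S v \<noteq> {..<d v}"
  shows "(\<Sum>v\<in>verts Q. card (S v) * (d v - card (S v))) <
    (\<Sum>a\<in>arcs Q. (d (tail Q a) - card (S (tail Q a))) * card (S (head Q a)))"
proof (rule ccontr)
  assume "\<not> ?thesis"
  then have neg: "(\<Sum>a\<in>arcs Q. (d (tail Q a) - card (S (tail Q a))) * card (S (head Q a))) \<le>
    (\<Sum>v\<in>verts Q. card (S v) * (d v - card (S v)))" by simp
  interpret Q: fin_digraph Q by (rule Q)
  define t where "t = tail Q"
  define h where "h = head Q"
  have th: "t a \<in> verts Q" "h a \<in> verts Q" if "a \<in> arcs Q" for a
    using that by (auto simp: t_def h_def)
  have S: "S v \<subseteq> {..<d v}" if "v \<in> verts Q" for v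
    using that N unfolding frame_def by blast
  have finS: "finite (S v)" if "v \<in> verts Q" for v
    using S[OF that] by (metis finite_lessThan finite_subset)
  have card_co: "card ({..<d v} - S v) = d v - card (S v)" if "v \<in> verts Q" for v
    using S[OF that] finS[OF that] by (simp add: card_Diff_subset)
  define Z where "Z = (SIGMA v:verts Q. ({..<d v} - S v) \<times> S v)"
  define I where "I = insert None (Some ` Z)"
  define J where "J = (SIGMA a:arcs Q. S (h a) \<times> ({..<d (t a)} - S (t a)))"
  \<comment> \<open>the unknowns are the scalar, at \<open>None\<close>, and the coordinates of the images of the unit\<close>
  \<comment> \<open>vectors outside \<open>S v\<close>; \<open>G\<close> is the endomorphism at \<open>v\<close> in the coordinates \<open>S v\<close> of its image\<close>
  define G :: "(('v \<times> nat \<times> nat) option \<Rightarrow> 'k) \<Rightarrow> 'v \<Rightarrow> nat \<Rightarrow> nat \<Rightarrow> 'k" where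
    "G x v s q = (if q \<in> S v
      then (if s = q then x None else 0) - (\<Sum>i\<in>{..<d v} - S v. N v i q * x (Some (v, i, s)))
      else x (Some (v, q, s)))" for x v s q
  \<comment> \<open>\<open>Y a\<close> is the restriction of the arrow \<open>a\<close> to the subrepresentation, in frame coordinates\<close>
  define Y where "Y a s l = (\<Sum>q<d (t a). f (a, s, q) * N (t a) q l)" for a s l
  define D where "D x a s q = (\<Sum>l\<in>S (t a). Y a s l * G x (t a) l q) - (\<Sum>p<d (h a). G x (h a) s p * f (a, p, q))"
    for x a s q
  have finZ: "finite Z" using finS by (simp add: Z_def)
  have "card Z = (\<Sum>v\<in>verts Q. card (S v) * (d v - card (S v)))"
    using finS by (simp add: Z_def card_cartesian_product card_co mult.commute)
  moreover have "card I = Suc (card Z)"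
    using finZ unfolding I_def by (subst card_insert_disjoint) (auto simp: card_image)
  moreover have "card J = (\<Sum>a\<in>arcs Q. (d (t a) - card (S (t a))) * card (S (h a)))"
    using th finS by (simp add: J_def card_cartesian_product card_co mult.commute)
  ultimately have card: "card J < card I" using neg by (simp add: t_def h_def)
  have G_lin: "linear_form (\<lambda>x. G x v s q)" for v s q
  proof -
    have zero_or_coord: "linear_form (\<lambda>x :: ('v \<times> nat \<times> nat) option \<Rightarrow> 'k. if s = q then x None else 0)"
      by (cases "s = q") (simp_all add: linear_form_intros)
    show ?thesis
      unfolding G_def
      by (cases "q \<in> S v") (simp_all add: linear_form_coord linear_form_diff[OF zero_or_coord] linear_form_sum linear_form_cmult)
  qed
  have D_lin: "linear_form (\<lambda>x. D x a s q)" for a s q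
    unfolding D_def by (intro linear_form_intros G_lin)
  have "\<exists>x. supported_on I x \<and> (\<exists>i\<in>I. x i \<noteq> 0) \<and> (\<forall>j\<in>J. (case j of (a, s, q) \<Rightarrow> D x a s q) = 0)"
    using th finS finZ
    by (intro underdetermined_system[OF _ _ card]) (auto simp: J_def I_def D_lin)
  then obtain x where x: "\<exists>i\<in>I. x i \<noteq> 0" and D0: "\<And>a s q. (a, s, q) \<in> J \<Longrightarrow> D x a s q = 0"
    by fastforce
  have GN: "(\<Sum>q<d v. G x v s q * N v q l) = (if s = l then x None else 0)"
    if v: "v \<in> verts Q" "s \<in> S v" "l \<in> S v" for v s l
  proof -
    have "(\<Sum>q\<in>{..<d v} - S v. G x v s q * N v q l) = (\<Sum>i\<in>{..<d v} - S v. N v i l * x (Some (v, i, s)))"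
      by (intro sum.cong) (auto simp: G_def)
    then show ?thesis unfolding frame_sum_right[OF N v(1,3)] using v by (simp add: G_def)
  qed
  have fN: "(\<Sum>q<d (t a). f (a, p, q) * N (t a) q l) = (\<Sum>k\<in>S (h a). N (h a) p k * Y a k l)"
    if "a \<in> arcs Q" "p < d (h a)" "l \<in> S (t a)" for a p l
    using pr that unfolding preserves_def Y_def t_def h_def by blast
  have delta_l: "(\<Sum>k\<in>S v. g k * (if k = l then c else 0)) = g l * c" if "v \<in> verts Q" "l \<in> S v" for v l c and g :: "nat \<Rightarrow> 'k"
  proof -
    have "(\<Sum>k\<in>S v. g k * (if k = l then c else 0)) = (\<Sum>k\<in>S v. if k = l then g k * c else 0)"
      by (intro sum.cong) auto
    then show ?thesis using that finS by simp
  qed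
  \<comment> \<open>the equations kill \<open>D\<close> on the unit vectors outside \<open>S (t a)\<close>; on the subspace it vanishes\<close>
  \<comment> \<open>because both terms are \<open>x None\<close> times the restricted arrow\<close>
  have D: "D x a s q = 0" if a: "a \<in> arcs Q" and s: "s \<in> S (h a)" and q: "q < d (t a)" for a s q
  proof (cases "q \<in> S (t a)")
    case False
    then show ?thesis using D0 that by (simp add: J_def)
  next
    case l: True
    have off: "(\<Sum>q'\<in>{..<d (t a)} - S (t a). D x a s q' * N (t a) q' q) = 0"
      using D0 a s by (intro sum.neutral) (auto simp: J_def)
    have "(\<Sum>q'<d (t a). D x a s q' * N (t a) q' q) =
        (\<Sum>k\<in>S (t a). Y a s k * (\<Sum>q'<d (t a). G x (t a) k q' * N (t a) q' q)) -
        (\<Sum>p<d (h a). G x (h a) s p * (\<Sum>q'<d (t a). f (a, p, q') * N (t a) q' q))"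
      unfolding D_def left_diff_distrib sum_subtractf sum_distrib_left sum_distrib_right
      by (subst (2 4) sum.swap) (simp add: mult.assoc)
    also have "(\<Sum>k\<in>S (t a). Y a s k * (\<Sum>q'<d (t a). G x (t a) k q' * N (t a) q' q)) =
        (\<Sum>k\<in>S (t a). Y a s k * (if k = q then x None else 0))"
      using GN th(1)[OF a] l by (intro sum.cong) auto
    also have "\<dots> = Y a s q * x None" using delta_l[OF th(1)[OF a] l] .
    also have "(\<Sum>p<d (h a). G x (h a) s p * (\<Sum>q'<d (t a). f (a, p, q') * N (t a) q' q)) =
        (\<Sum>p<d (h a). G x (h a) s p * (\<Sum>k\<in>S (h a). N (h a) p k * Y a k q))"
      using fN[OF a _ l] by (intro sum.cong) auto
    also have "\<dots> = (\<Sum>k\<in>S (h a). Y a k q * (\<Sum>p<d (h a). G x (h a) s p * N (h a) p k))"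
      unfolding sum_distrib_left by (subst sum.swap) (simp add: mult_ac)
    also have "\<dots> = (\<Sum>k\<in>S (h a). Y a k q * (if k = s then x None else 0))"
      using GN[OF th(2)[OF a] s] by (intro sum.cong) auto
    also have "\<dots> = Y a s q * x None" using delta_l[OF th(2)[OF a] s] .
    finally have "(\<Sum>q'<d (t a). D x a s q' * N (t a) q' q) = 0" by simp
    then show ?thesis using frame_sum_right[OF N th(1)[OF a] l, of "D x a s"] off by simp
  qed
  define \<psi> where "\<psi> = (\<lambda>(v, p, q). \<Sum>s\<in>S v. N v p s * G x v s q)"
  have "is_endo Q d f \<psi>"
    unfolding is_endo_def t_def[symmetric] h_def[symmetric]
  proof (intro ballI allI impI)
    fix a p q assume a: "a \<in> arcs Q" and p: "p < d (h a)" and q: "q < d (t a)"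
    have "(\<Sum>l<d (t a). f (a, p, l) * \<psi> (t a, l, q)) =
        (\<Sum>s\<in>S (t a). (\<Sum>l<d (t a). f (a, p, l) * N (t a) l s) * G x (t a) s q)"
      unfolding \<psi>_def prod.case sum_distrib_left sum_distrib_right by (subst sum.swap) (simp add: mult.assoc)
    also have "\<dots> = (\<Sum>s\<in>S (t a). (\<Sum>k\<in>S (h a). N (h a) p k * Y a k s) * G x (t a) s q)"
      using fN[OF a p] by (intro sum.cong) auto
    also have "\<dots> = (\<Sum>k\<in>S (h a). N (h a) p k * (\<Sum>s\<in>S (t a). Y a k s * G x (t a) s q))"
      unfolding sum_distrib_left sum_distrib_right by (subst sum.swap) (simp add: mult.assoc)
    also have "\<dots> = (\<Sum>k\<in>S (h a). N (h a) p k * (\<Sum>l<d (h a). G x (h a) k l * f (a, l, q)))"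
      using D[OF a _ q] unfolding D_def by (intro sum.cong) auto
    also have "\<dots> = (\<Sum>l<d (h a). \<psi> (h a, p, l) * f (a, l, q))"
      unfolding \<psi>_def prod.case sum_distrib_left sum_distrib_right by (subst sum.swap) (simp add: mult.assoc)
    finally show "(\<Sum>l<d (t a). f (a, p, l) * \<psi> (t a, l, q)) = (\<Sum>l<d (h a). \<psi> (h a, p, l) * f (a, l, q))" .
  qed
  then obtain c where c: "\<And>v p q. v \<in> verts Q \<Longrightarrow> p < d v \<Longrightarrow> q < d v \<Longrightarrow> \<psi> (v, p, q) = (if p = q then c else 0)"
    using f unfolding brick_def by blast
  have \<psi>G: "\<psi> (v, s, q) = G x v s q" if "v \<in> verts Q" "s \<in> S v" for v s q
    using frame_sum_left[OF N that] by (simp add: \<psi>_def)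
  \<comment> \<open>at a vertex with a proper subspace, a scalar with image in the subspace is zero\<close>
  obtain u p where u: "u \<in> verts Q" "p < d u" "p \<notin> S u" using proper S by blast
  have "\<psi> (u, p, p) = (\<Sum>s\<in>S u. N u p s * \<psi> (u, s, p))"
    using \<psi>G[OF u(1)] by (simp add: \<psi>_def)
  also have "\<dots> = 0"
  proof (intro sum.neutral ballI)
    fix s assume "s \<in> S u"
    then have "s < d u" "s \<noteq> p" using u S by auto
    then show "N u p s * \<psi> (u, s, p) = 0" using c[OF u(1), of s p] u by simp
  qed
  finally have "c = 0" using c[OF u(1,2,2)] by simp
  then have G0: "G x v s q = 0" if "v \<in> verts Q" "s \<in> S v" "q < d v" for v s q
    using \<psi>G[OF that(1,2), of q] c[of v s q] that S[OF that(1)] by (auto split: if_splits)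
  obtain v s where v: "v \<in> verts Q" "s \<in> S v" using nonzero by blast
  have "x None = 0" using GN[OF v v(2)] G0[OF v] by simp
  moreover have "x (Some z) = 0" if "z \<in> Z" for z
  proof -
    obtain v q s where z: "z = (v, q, s)" by (cases z)
    then have "v \<in> verts Q" "s \<in> S v" "q < d v" "q \<notin> S v" using that by (auto simp: Z_def)
    then show ?thesis using G0[of v s q] by (simp add: G_def z)
  qed
  ultimately show False using x by (auto simp: I_def)
qed


text \<open>
  Being an endomorphism is a linear system that is linear in \<open>f\<close>. One more equation, the vanishing of
  a diagonal entry, singles out one representative modulo scalars, so that bricks become the
  representations with an injective system.
\<close>
lemma generically_brick:
  fixes Q :: "('v, 'a) pre_digraph" and f0 :: "'a \<times> nat \<times> nat \<Rightarrow> 'k::field"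
  assumes Q: "fin_digraph Q" and f0: "brick Q d f0"
  shows "generically (brick Q d :: ('a \<times> nat \<times> nat \<Rightarrow> 'k) \<Rightarrow> bool)"
proof -
  interpret Q: fin_digraph Q by (rule Q)
  define t where "t = tail Q"
  define h where "h = head Q"
  have th: "t a \<in> verts Q" "h a \<in> verts Q" if "a \<in> arcs Q" for a
    using that by (auto simp: t_def h_def)
  obtain u where u: "u \<in> verts Q" "d u \<noteq> 0" using f0 unfolding brick_def by blast
  define I where "I = (SIGMA v:verts Q. {..<d v} \<times> {..<d v})"
  define J where "J = insert None (Some ` (SIGMA a:arcs Q. {..<d (h a)} \<times> {..<d (t a)}))"
  define E :: "('a \<times> nat \<times> nat \<Rightarrow> 'k) \<Rightarrow> ('a \<times> nat \<times> nat) \<Rightarrow> ('v \<times> nat \<times> nat \<Rightarrow> 'k) \<Rightarrow> 'k" where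
    "E f = (\<lambda>(a, p, q) x. (\<Sum>l<d (t a). f (a, p, l) * x (t a, l, q)) - (\<Sum>l<d (h a). x (h a, p, l) * f (a, l, q)))" for f
  define L where "L f j x = (case j of None \<Rightarrow> x (u, 0, 0) | Some b \<Rightarrow> E f b x)" for f j x
  have E_lin: "linear_form (E f b)" for f b
    by (cases b) (simp add: E_def linear_form_intros)
  have L_lin: "linear_form (L f j)" for f j
    unfolding L_def by (cases j) (simp_all add: linear_form_coord E_lin)
  have E_aff: "E (segment f g s) b x = E f b x + s * (E g b x - E f b x)" for f g s b x
    by (cases b) (simp add: E_def segment_def algebra_simps sum.distrib sum_subtractf sum_distrib_left)
  have endo: "is_endo Q d f x \<longleftrightarrow> (\<forall>b. Some b \<in> J \<longrightarrow> E f b x = 0)" for f x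
    by (fastforce simp: is_endo_def E_def J_def t_def h_def)
  have brick: "brick Q d f \<longleftrightarrow> (\<forall>x. supported_on I x \<longrightarrow> (\<forall>j\<in>J. L f j x = 0) \<longrightarrow> (\<forall>i. x i = 0))" for f
  proof
    assume f: "brick Q d f"
    show "\<forall>x. supported_on I x \<longrightarrow> (\<forall>j\<in>J. L f j x = 0) \<longrightarrow> (\<forall>i. x i = 0)"
    proof (intro allI impI)
      fix x i assume x: "supported_on I x" "\<forall>j\<in>J. L f j x = 0"
      have "is_endo Q d f x" unfolding endo using x(2) by (force simp: L_def)
      then obtain c where c: "\<And>v p q. v \<in> verts Q \<Longrightarrow> p < d v \<Longrightarrow> q < d v \<Longrightarrow> x (v, p, q) = (if p = q then c else 0)"
        using f unfolding brick_def by blast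
      have "x (u, 0, 0) = 0" using x(2) by (auto simp: J_def L_def)
      then have "c = 0" using c[OF u(1), of 0 0] u(2) by simp
      then have "x i = 0" if "i \<in> I" using c that by (auto simp: I_def)
      then show "x i = 0" using x(1) unfolding supported_on_def by blast
    qed
  next
    assume inj: "\<forall>x. supported_on I x \<longrightarrow> (\<forall>j\<in>J. L f j x = 0) \<longrightarrow> (\<forall>i. x i = 0)"
    have "\<forall>v\<in>verts Q. \<forall>p<d v. \<forall>q<d v. x (v, p, q) = (if p = q then x (u, 0, 0) else 0)"
      if x: "is_endo Q d f x" for x
    proof -
      define y where "y = (\<lambda>(v, p, q). if (v, p, q) \<in> I then x (v, p, q) - (if p = q then x (u, 0, 0) else 0) else 0)"
      have y: "supported_on I y" by (auto simp: y_def supported_on_def)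
      have "E f (a, p, q) y = 0" if a: "a \<in> arcs Q" and pq: "p < d (h a)" "q < d (t a)" for a p q
      proof -
        have "(\<Sum>l<d (t a). f (a, p, l) * y (t a, l, q)) =
            (\<Sum>l<d (t a). f (a, p, l) * x (t a, l, q) - (if l = q then f (a, p, l) * x (u, 0, 0) else 0))"
          using th(1)[OF a] pq by (intro sum.cong) (auto simp: y_def I_def algebra_simps)
        also have "\<dots> = (\<Sum>l<d (t a). f (a, p, l) * x (t a, l, q)) - f (a, p, q) * x (u, 0, 0)"
          using pq by (simp add: sum_subtractf)
        finally have 1: "(\<Sum>l<d (t a). f (a, p, l) * y (t a, l, q)) = \<dots>" .
        have "(\<Sum>l<d (h a). y (h a, p, l) * f (a, l, q)) =
            (\<Sum>l<d (h a). x (h a, p, l) * f (a, l, q) - (if l = p then f (a, l, q) * x (u, 0, 0) else 0))"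
          using th(2)[OF a] pq by (intro sum.cong) (auto simp: y_def I_def algebra_simps)
        also have "\<dots> = (\<Sum>l<d (h a). x (h a, p, l) * f (a, l, q)) - f (a, p, q) * x (u, 0, 0)"
          using pq by (simp add: sum_subtractf)
        finally have 2: "(\<Sum>l<d (h a). y (h a, p, l) * f (a, l, q)) = \<dots>" .
        have "(\<Sum>l<d (t a). f (a, p, l) * x (t a, l, q)) = (\<Sum>l<d (h a). x (h a, p, l) * f (a, l, q))"
          using x a pq by (simp add: is_endo_def t_def h_def)
        then show ?thesis unfolding E_def prod.case 1 2 by simp
      qed
      moreover have "y (u, 0, 0) = 0" by (simp add: y_def)
      ultimately have "\<forall>j\<in>J. L f j y = 0" by (auto simp: J_def L_def)
      then have y0: "y i = 0" for i using inj y by blast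
      show ?thesis
      proof (intro ballI allI impI)
        fix v p q assume "v \<in> verts Q" "p < d v" "q < d v"
        then show "x (v, p, q) = (if p = q then x (u, 0, 0) else 0)"
          using y0[of "(v, p, q)"] by (simp add: y_def I_def)
      qed
    qed
    then show "brick Q d f" unfolding brick_def using u by blast
  qed
  show ?thesis
    unfolding brick
  proof (rule generically_injective[of I J L f0])
    show "finite I" by (simp add: I_def)
    show "L (segment f g s) j x = L f j x + s * (L g j x - L f j x)" for f g s j x
      by (cases j) (simp_all add: L_def E_aff)
    show "\<forall>i. x i = 0" if "supported_on I x" "\<forall>j\<in>J. L f0 j x = 0" for x
      using f0 that unfolding brick by blast
  qed (rule L_lin)
qed

text \<open>
  The necessary half of Schofield's criterion for Schur roots: if there is a brick of dimension \<open>d\<close>,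
  then \<open>\<langle>e, d - e\<rangle> > \<langle>d - e, e\<rangle>\<close> for the dimension \<open>e\<close> of every proper nonzero subrepresentation of the
  generic representation. Indeed the left side is not negative by the dimension count, the right
  side is negative for bricks, and only finitely many charts have to be avoided.
\<close>
theorem generically_canonically_stable:
  fixes Q :: "('v, 'a) pre_digraph" and f0 :: "'a \<times> nat \<times> nat \<Rightarrow> 'k::field"
  assumes Q: "fin_digraph Q" and inf: "infinite (UNIV :: 'k set)" and f0: "brick Q d f0"
  shows "generically (\<lambda>f :: 'a \<times> nat \<times> nat \<Rightarrow> 'k. brick Q d f \<and>
    (\<forall>S N. frame Q d S N \<longrightarrow> preserves Q d S N f \<longrightarrow>
      (\<exists>v\<in>verts Q. S v \<noteq> {}) \<longrightarrow> (\<exists>v\<in>verts Q. S v \<noteq> {..<d v}) \<longrightarrow>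
      (\<Sum>a\<in>arcs Q. card (S (tail Q a)) * (d (head Q a) - card (S (head Q a)))) <
      (\<Sum>a\<in>arcs Q. (d (tail Q a) - card (S (tail Q a))) * card (S (head Q a)))))"
proof -
  interpret Q: fin_digraph Q by (rule Q)
  define selfform where "selfform S = (\<Sum>v\<in>verts Q. card (S v) * (d v - card (S v)))" for S :: "'v \<Rightarrow> nat set"
  define outer where "outer S = (\<Sum>a\<in>arcs Q. card (S (tail Q a)) * (d (head Q a) - card (S (head Q a))))"
    for S :: "'v \<Rightarrow> nat set"
  define \<S> where "\<S> = {S \<in> \<Pi>\<^sub>E v\<in>verts Q. Pow {..<d v}. selfform S < outer S}"
  have "finite \<S>" by (simp add: \<S>_def finite_PiE)
  then have gen: "generically (\<lambda>f :: 'a \<times> nat \<times> nat \<Rightarrow> 'k. \<forall>S\<in>\<S>. \<nexists>N. frame Q d S N \<and> preserves Q d S N f)"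
  proof (rule generically_ball[OF inf])
    fix S assume S: "S \<in> \<S>"
    then show "generically (\<lambda>f :: 'a \<times> nat \<times> nat \<Rightarrow> 'k. \<nexists>N. frame Q d S N \<and> preserves Q d S N f)"
      by (intro generically_no_subrepresentation[OF Q inf]) (auto simp: \<S>_def selfform_def outer_def)
  qed
  show ?thesis
  proof (rule generically_mono[OF generically_conj[OF inf generically_brick[OF Q f0] gen]],
      elim conjE, intro conjI allI impI)
    fix f :: "'a \<times> nat \<times> nat \<Rightarrow> 'k" and S N
    assume f: "brick Q d f" and no: "\<forall>S\<in>\<S>. \<nexists>N. frame Q d S N \<and> preserves Q d S N f"
      and N: "frame Q d S N" "preserves Q d S N f"
      and ne: "\<exists>v\<in>verts Q. S v \<noteq> {}" "\<exists>v\<in>verts Q. S v \<noteq> {..<d v}"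
    let ?S = "restrict S (verts Q)"
    have "frame Q d ?S N" "preserves Q d ?S N f"
      using N by (simp_all add: frame_def preserves_def)
    then have "?S \<notin> \<S>" using no by blast
    moreover have "?S \<in> (\<Pi>\<^sub>E v\<in>verts Q. Pow {..<d v})" using N(1) by (auto simp: frame_def)
    ultimately have "outer ?S \<le> selfform ?S" by (simp add: \<S>_def)
    then have "outer S \<le> selfform S" by (simp add: outer_def selfform_def)
    then show "(\<Sum>a\<in>arcs Q. card (S (tail Q a)) * (d (head Q a) - card (S (head Q a)))) <
      (\<Sum>a\<in>arcs Q. (d (tail Q a) - card (S (tail Q a))) * card (S (head Q a)))"
      using brick_subrepresentation[OF Q f N ne] by (simp add: outer_def selfform_def)
  qed
qed

section \<open>Matrix representations and their coordinates\<close>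

definition coords :: "('a \<Rightarrow> 'k mat) \<Rightarrow> 'a \<times> nat \<times> nat \<Rightarrow> 'k" where
  "coords X = (\<lambda>(a, p, q). X a $$ (p, q))"

definition rep_of_coords :: "('v, 'a) pre_digraph \<Rightarrow> ('v \<Rightarrow> nat) \<Rightarrow> ('a \<times> nat \<times> nat \<Rightarrow> 'k) \<Rightarrow> 'a \<Rightarrow> 'k mat" where
  "rep_of_coords Q d f = (\<lambda>a. mat (d (head Q a)) (d (tail Q a)) (\<lambda>(p, q). f (a, p, q)))"

lemma trivial_End_brick:
  fixes X :: "'a \<Rightarrow> 'k::field mat"
  assumes Q: "fin_digraph Q" and X: "is_rep Q d X" and triv: "trivial_End Q d X"
  shows "brick Q d (coords X)"
proof -
  interpret Q: fin_digraph Q by (rule Q)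
  have Xc: "X a \<in> carrier_mat (d (head Q a)) (d (tail Q a))" if "a \<in> arcs Q" for a
    using X that unfolding is_rep_def by blast
  have "\<exists>v\<in>verts Q. d v \<noteq> 0"
  proof (rule ccontr)
    assume "\<not> (\<exists>v\<in>verts Q. d v \<noteq> 0)"
    then have "scalar_endo Q d (0 :: 'k) = scalar_endo Q d 1"
      unfolding scalar_endo_def by (intro restrict_ext eq_matI) auto
    then show False using triv unfolding trivial_End_def bij_betw_def inj_on_def by (metis UNIV_I zero_neq_one)
  qed
  moreover have "\<exists>c. \<forall>v\<in>verts Q. \<forall>p<d v. \<forall>q<d v. x (v, p, q) = (if p = q then c else 0)"
    if x: "is_endo Q d (coords X) x" for x
  proof -
    define \<phi> where "\<phi> = (\<lambda>v\<in>verts Q. mat (d v) (d v) (\<lambda>(p, q). x (v, p, q)))"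
    have "X a * \<phi> (tail Q a) = \<phi> (head Q a) * X a" if a: "a \<in> arcs Q" for a
    proof (rule eq_matI)
      have v: "tail Q a \<in> verts Q" "head Q a \<in> verts Q" using a by auto
      note dims = carrier_matD[OF Xc[OF a]]
      fix p q assume "p < dim_row (\<phi> (head Q a) * X a)" "q < dim_col (\<phi> (head Q a) * X a)"
      then have pq: "p < d (head Q a)" "q < d (tail Q a)" using v dims by (auto simp: \<phi>_def)
      have "(\<Sum>l<d (tail Q a). X a $$ (p, l) * x (tail Q a, l, q)) =
          (\<Sum>l<d (head Q a). x (head Q a, p, l) * X a $$ (l, q))"
        using x a pq by (simp add: is_endo_def coords_def)
      then show "(X a * \<phi> (tail Q a)) $$ (p, q) = (\<phi> (head Q a) * X a) $$ (p, q)"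
        using v dims pq by (simp add: \<phi>_def scalar_prod_def atLeast0LessThan)
    qed (use Xc[OF a] a in \<open>auto simp: \<phi>_def\<close>)
    then have "\<phi> \<in> End_rep Q d X" by (auto simp: End_rep_def \<phi>_def)
    then obtain c where c: "\<phi> = scalar_endo Q d c"
      using triv unfolding trivial_End_def bij_betw_def by blast
    have scalar: "mat (d v) (d v) (\<lambda>(p, q). x (v, p, q)) = c \<cdot>\<^sub>m 1\<^sub>m (d v)" if "v \<in> verts Q" for v
      using that fun_cong[OF c, of v] by (simp add: \<phi>_def scalar_endo_def)
    have "x (v, p, q) = (if p = q then c else 0)" if "v \<in> verts Q" "p < d v" "q < d v" for v p q
    proof -
      have "x (v, p, q) = mat (d v) (d v) (\<lambda>(p, q). x (v, p, q)) $$ (p, q)" using that by simp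
      also have "\<dots> = (c \<cdot>\<^sub>m 1\<^sub>m (d v)) $$ (p, q)"
        using scalar that by simp
      finally show ?thesis using that by simp
    qed
    then show ?thesis by blast
  qed
  ultimately show ?thesis unfolding brick_def by blast
qed

text \<open>
  At every vertex a chart is chosen independently; invariance is tested on the columns of the frame.
\<close>
lemma subrep_frame:
  fixes U :: "'v \<Rightarrow> 'k::field vec set"
  assumes Q: "fin_digraph Q" and U: "is_subrep Q d (rep_of_coords Q d f) U"
  shows "\<exists>S N. frame Q d S N \<and> preserves Q d S N f \<and> (\<forall>v\<in>verts Q. coordinatized (d v) (S v) (N v) (U v))"
proof -
  interpret Q: fin_digraph Q by (rule Q)
  have "\<forall>v\<in>verts Q. \<exists>S N. coordinatized (d v) S N (U v)"
    using U subspace_coordinatized unfolding is_subrep_def by blast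
  then obtain S N where c: "\<And>v. v \<in> verts Q \<Longrightarrow> coordinatized (d v) (S v) (N v) (U v)" by metis
  have "frame Q d S N" using c unfolding frame_def coordinatized_def by blast
  moreover have "preserves Q d S N f"
    unfolding preserves_def
  proof (intro ballI allI impI)
    fix a p s assume a: "a \<in> arcs Q" and p: "p < d (head Q a)" and s: "s \<in> S (tail Q a)"
    then have v: "tail Q a \<in> verts Q" "head Q a \<in> verts Q" by auto
    let ?y = "rep_of_coords Q d f a *\<^sub>v vec (d (tail Q a)) (\<lambda>p. N (tail Q a) p s)"
    have y: "?y \<in> U (head Q a)"
      using U a coordinatized_column[OF c[OF v(1)] s] unfolding is_subrep_def by blast
    have yp: "?y $ l = (\<Sum>q<d (tail Q a). f (a, l, q) * N (tail Q a) q s)" if "l < d (head Q a)" for l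
      using that by (simp add: rep_of_coords_def scalar_prod_def atLeast0LessThan)
    have "S (head Q a) \<subseteq> {..<d (head Q a)}" using c[OF v(2)] unfolding coordinatized_def by blast
    moreover have "?y $ p = (\<Sum>l\<in>S (head Q a). N (head Q a) p l * ?y $ l)"
      using y p c[OF v(2)] unfolding coordinatized_def by blast
    ultimately show "(\<Sum>q<d (tail Q a). f (a, p, q) * N (tail Q a) q s) =
      (\<Sum>l\<in>S (head Q a). N (head Q a) p l * (\<Sum>q<d (tail Q a). f (a, l, q) * N (tail Q a) q s))"
      using yp p by (auto simp: subset_iff cong: sum.cong)
  qed
  ultimately show ?thesis using c by blast
qed

section \<open>Stable representations are bricks\<close>

lemma square_matrix_kernel_image:
  fixes A :: "'k::field mat"
  assumes A: "A \<in> carrier_mat n n"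
  defines "K \<equiv> {x \<in> carrier_vec n. A *\<^sub>v x = 0\<^sub>v n}"
    and "I \<equiv> (\<lambda>x. A *\<^sub>v x) ` carrier_vec n"
  shows "VectorSpace.subspace class_ring K (module_vec TYPE('k) n)"
    and "VectorSpace.subspace class_ring I (module_vec TYPE('k) n)"
    and "vectorspace.dim class_ring (module_vec TYPE('k) n\<lparr>carrier := I\<rparr>) +
      vectorspace.dim class_ring (module_vec TYPE('k) n\<lparr>carrier := K\<rparr>) = n"
proof -
  interpret V: vec_space "TYPE('k)" n .
  have "linear_map class_ring V.V V.V (\<lambda>x. A *\<^sub>v x)"
  proof
    show "(\<lambda>x. A *\<^sub>v x) \<in> LinearCombinations.module_hom class_ring V.V V.V"
      unfolding LinearCombinations.module_hom_def
      using A mult_add_distrib_mat_vec[OF A] mult_mat_vec[OF A] by (auto simp: module_vec_simps)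
  qed
  then interpret T: linear_map class_ring V.V V.V "\<lambda>x. A *\<^sub>v x" .
  have K: "T.kerT = K" by (simp add: T.ker_def K_def module_vec_simps)
  have I: "T.imT = I" by (simp add: T.im_def I_def module_vec_simps)
  show "VectorSpace.subspace class_ring K (module_vec TYPE('k) n)"
    using T.kerT_is_subspace K by simp
  show "VectorSpace.subspace class_ring I (module_vec TYPE('k) n)"
    using T.imT_is_subspace I by simp
  show "vectorspace.dim class_ring (module_vec TYPE('k) n\<lparr>carrier := I\<rparr>) +
      vectorspace.dim class_ring (module_vec TYPE('k) n\<lparr>carrier := K\<rparr>) = n"
    using T.rank_nullity V.fin_dim V.dim_is_n K I by simp
qed

lemma zero_mat_if_annihilates:
  fixes A :: "'k::field mat"
  assumes A: "A \<in> carrier_mat n n" and "\<And>x. x \<in> carrier_vec n \<Longrightarrow> A *\<^sub>v x = 0\<^sub>v n"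
  shows "A = 0\<^sub>m n n"
proof (rule eq_matI)
  fix i j assume ij: "i < dim_row (0\<^sub>m n n :: 'k mat)" "j < dim_col (0\<^sub>m n n :: 'k mat)"
  have "(A *\<^sub>v unit_vec n j) $ i = 0" using assms(2) ij by simp
  then show "A $$ (i, j) = 0\<^sub>m n n $$ (i, j)" using ij A by simp
qed (use A in auto)

text \<open>
  Schur's lemma. Subtract from an endomorphism an eigenvalue \<open>c\<close> at some vertex. Kernel and image of
  the difference are subrepresentations whose weights add up to the weight of \<open>d\<close>, which is 0. The
  kernel is nonzero; if it were proper, stability would make its weight negative and that of the
  image not positive.
\<close>
theorem stable_trivial_End:
  fixes X :: "'a \<Rightarrow> 'k::alg_closed_field mat"
  assumes Q: "fin_digraph Q" and X: "is_rep Q d X" and st: "stable_rep Q \<theta> d X"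
  shows "trivial_End Q d X"
proof -
  interpret Q: fin_digraph Q by (rule Q)
  have Xc: "X a \<in> carrier_mat (d (head Q a)) (d (tail Q a))" if "a \<in> arcs Q" for a
    using X that unfolding is_rep_def by blast
  obtain u where u: "u \<in> verts Q" "d u \<noteq> 0" using st unfolding stable_rep_def by blast
  have inj: "inj (scalar_endo Q d :: 'k \<Rightarrow> _)"
  proof (rule injI)
    fix b c :: 'k assume bc: "scalar_endo Q d b = scalar_endo Q d c"
    have "b \<cdot>\<^sub>m 1\<^sub>m (d u) = c \<cdot>\<^sub>m 1\<^sub>m (d u)" using u(1) fun_cong[OF bc, of u] by (simp add: scalar_endo_def)
    then have "(b \<cdot>\<^sub>m 1\<^sub>m (d u)) $$ (0, 0) = (c \<cdot>\<^sub>m 1\<^sub>m (d u)) $$ (0, 0)" by simp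
    then show "b = c" using u(2) by simp
  qed
  have scalars: "scalar_endo Q d c \<in> End_rep Q d X" for c
  proof -
    have "X a * (c \<cdot>\<^sub>m 1\<^sub>m (d (tail Q a))) = c \<cdot>\<^sub>m 1\<^sub>m (d (head Q a)) * X a" if "a \<in> arcs Q" for a
      using Xc[OF that] mult_smult_distrib[OF Xc[OF that] one_carrier_mat]
        mult_smult_assoc_mat[OF one_carrier_mat Xc[OF that]] by simp
    then show ?thesis by (auto simp: End_rep_def scalar_endo_def)
  qed
  have "\<exists>c. \<phi> = scalar_endo Q d c" if \<phi>: "\<phi> \<in> End_rep Q d X" for \<phi>
  proof -
    have \<phi>c: "\<phi> v \<in> carrier_mat (d v) (d v)" if "v \<in> verts Q" for v
      using \<phi> that by (auto simp: End_rep_def)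
    have comm: "X a * \<phi> (tail Q a) = \<phi> (head Q a) * X a" if "a \<in> arcs Q" for a
      using \<phi> that by (auto simp: End_rep_def)
    have "degree (char_poly (\<phi> u)) > 0" using degree_monic_char_poly[OF \<phi>c[OF u(1)]] u(2) by simp
    then obtain c where "poly (char_poly (\<phi> u)) c = 0" using alg_closed_imp_poly_has_root by blast
    then have "eigenvalue (\<phi> u) c" using eigenvalue_root_char_poly[OF \<phi>c[OF u(1)]] by blast
    then obtain y where y: "y \<in> carrier_vec (d u)" "y \<noteq> 0\<^sub>v (d u)" "\<phi> u *\<^sub>v y = c \<cdot>\<^sub>v y"
      using \<phi>c[OF u(1)] unfolding eigenvalue_def eigenvector_def by auto
    define \<psi> where "\<psi> v = \<phi> v - c \<cdot>\<^sub>m 1\<^sub>m (d v)" for v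
    have \<psi>c: "\<psi> v \<in> carrier_mat (d v) (d v)" if "v \<in> verts Q" for v
      unfolding \<psi>_def using \<phi>c[OF that] by auto
    have \<psi>x: "\<psi> v *\<^sub>v x = \<phi> v *\<^sub>v x - c \<cdot>\<^sub>v x" if "v \<in> verts Q" "x \<in> carrier_vec (d v)" for v x
    proof -
      have "(c \<cdot>\<^sub>m 1\<^sub>m (d v)) *\<^sub>v x = c \<cdot>\<^sub>v x"
        using that(2) by (intro eq_vecI) auto
      then show ?thesis
        unfolding \<psi>_def using minus_mult_distrib_mat_vec[OF \<phi>c[OF that(1)] _ that(2)] by simp
    qed
    have Xx: "X a *\<^sub>v x \<in> carrier_vec (d (head Q a))" if "a \<in> arcs Q" "x \<in> carrier_vec (d (tail Q a))" for a x
      using mult_mat_vec_carrier[OF Xc[OF that(1)] that(2)] .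
    have \<psi>X: "\<psi> (head Q a) *\<^sub>v (X a *\<^sub>v x) = X a *\<^sub>v (\<psi> (tail Q a) *\<^sub>v x)"
      if a: "a \<in> arcs Q" and x: "x \<in> carrier_vec (d (tail Q a))" for a x
    proof -
      have v: "tail Q a \<in> verts Q" "head Q a \<in> verts Q" using a by auto
      have "\<phi> (head Q a) *\<^sub>v (X a *\<^sub>v x) = X a *\<^sub>v (\<phi> (tail Q a) *\<^sub>v x)"
        using comm[OF a] Xc[OF a] \<phi>c[OF v(1)] \<phi>c[OF v(2)] x by (metis assoc_mult_mat_vec)
      moreover have "X a *\<^sub>v (\<phi> (tail Q a) *\<^sub>v x - c \<cdot>\<^sub>v x) = X a *\<^sub>v (\<phi> (tail Q a) *\<^sub>v x) - c \<cdot>\<^sub>v (X a *\<^sub>v x)"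
        using Xc[OF a] \<phi>c[OF v(1)] x by (simp add: mult_minus_distrib_mat_vec mult_mat_vec)
      ultimately show ?thesis using \<psi>x[OF v(1) x] \<psi>x[OF v(2) Xx[OF a x]] by simp
    qed
    define K where "K v = {x \<in> carrier_vec (d v). \<psi> v *\<^sub>v x = 0\<^sub>v (d v)}" for v
    define I where "I v = (\<lambda>x. \<psi> v *\<^sub>v x) ` carrier_vec (d v)" for v
    note KI = square_matrix_kernel_image[OF \<psi>c, folded K_def I_def]
    have "is_subrep Q d X K"
      unfolding is_subrep_def
    proof (intro conjI ballI)
      fix a x assume a: "a \<in> arcs Q" and x: "x \<in> K (tail Q a)"
      have "X a *\<^sub>v 0\<^sub>v (d (tail Q a)) = 0\<^sub>v (d (head Q a))"
        using Xc[OF a] by (intro eq_vecI) auto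
      then show "X a *\<^sub>v x \<in> K (head Q a)"
        using x \<psi>X[OF a, of x] Xx[OF a, of x] Xc[OF a] by (simp add: K_def)
    qed (rule KI(1))
    have "is_subrep Q d X I"
      unfolding is_subrep_def
    proof (intro conjI ballI)
      fix a x assume a: "a \<in> arcs Q" and x: "x \<in> I (tail Q a)"
      then show "X a *\<^sub>v x \<in> I (head Q a)"
        using \<psi>X[OF a] Xx[OF a] by (auto simp: I_def) (metis imageI)
    qed (rule KI(2))
    have stab: "weight Q \<theta> (subrep_dim Q d U) < 0"
      if "is_subrep Q d X U" "\<exists>v\<in>verts Q. U v \<noteq> {0\<^sub>v (d v)}" "\<exists>v\<in>verts Q. U v \<noteq> carrier_vec (d v)" for U
      using st that unfolding stable_rep_def by blast
    have dims: "subrep_dim Q d I v + subrep_dim Q d K v = d v" if "v \<in> verts Q" for v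
      using KI(3)[OF that] that by (simp add: subrep_dim_def)
    have "weight Q \<theta> (subrep_dim Q d I) + weight Q \<theta> (subrep_dim Q d K) = weight Q \<theta> d"
      unfolding weight_def sum.distrib[symmetric]
      by (intro sum.cong) (simp_all add: dims[symmetric] distrib_left)
    moreover have d0: "weight Q \<theta> d = 0" using st unfolding stable_rep_def by blast
    ultimately have wsum: "weight Q \<theta> (subrep_dim Q d I) + weight Q \<theta> (subrep_dim Q d K) = 0" by simp
    have "y \<in> K u" using y \<psi>x[OF u(1) y(1)] by (simp add: K_def)
    then have K0: "\<exists>v\<in>verts Q. K v \<noteq> {0\<^sub>v (d v)}" using u y(2) by blast
    have Kfull: "\<forall>v\<in>verts Q. K v = carrier_vec (d v)"
    proof (rule ccontr)
      assume "\<not> (\<forall>v\<in>verts Q. K v = carrier_vec (d v))"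
      then obtain v where v: "v \<in> verts Q" "K v \<noteq> carrier_vec (d v)" by blast
      then have wK: "weight Q \<theta> (subrep_dim Q d K) < 0" using stab \<open>is_subrep Q d X K\<close> K0 by blast
      obtain x where "x \<in> carrier_vec (d v)" "\<psi> v *\<^sub>v x \<noteq> 0\<^sub>v (d v)" using v(2) by (auto simp: K_def)
      then have "I v \<noteq> {0\<^sub>v (d v)}" by (auto simp: I_def)
      then have I0: "\<exists>v\<in>verts Q. I v \<noteq> {0\<^sub>v (d v)}" using v(1) by blast
      have "weight Q \<theta> (subrep_dim Q d I) \<le> 0"
      proof (cases "\<exists>v\<in>verts Q. I v \<noteq> carrier_vec (d v)")
        case True
        then show ?thesis using stab[OF \<open>is_subrep Q d X I\<close> I0] by simp
      next
        case False
        have "subrep_dim Q d I v = d v" if "v \<in> verts Q" for v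
        proof -
          have "vectorspace.dim class_ring (module_vec TYPE('k) (d v)) = d v"
            by (rule vec_space.dim_is_n)
          moreover have "module_vec TYPE('k) (d v)\<lparr>carrier := carrier_vec (d v)\<rparr> = module_vec TYPE('k) (d v)"
            by (simp add: module_vec_def)
          ultimately show ?thesis using False that by (simp add: subrep_dim_def)
        qed
        then have "weight Q \<theta> (subrep_dim Q d I) = weight Q \<theta> d" by (simp add: weight_def)
        then show ?thesis using d0 by simp
      qed
      then show False using wsum wK by simp
    qed
    have \<phi>v: "\<phi> v = c \<cdot>\<^sub>m 1\<^sub>m (d v)" if v: "v \<in> verts Q" for v
    proof -
      have "\<psi> v *\<^sub>v x = 0\<^sub>v (d v)" if "x \<in> carrier_vec (d v)" for x
        using Kfull v that by (auto simp: K_def)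
      then have "\<psi> v = 0\<^sub>m (d v) (d v)" by (intro zero_mat_if_annihilates[OF \<psi>c[OF v]])
      then have *: "\<psi> v $$ (i, j) = 0" if "i < d v" "j < d v" for i j using that by simp
      show ?thesis
        using * \<phi>c[OF v] by (intro eq_matI) (auto simp: \<psi>_def)
    qed
    have "\<phi> \<in> extensional (verts Q)" using \<phi> by (auto simp: End_rep_def PiE_def)
    then have "\<phi> = scalar_endo Q d c"
      unfolding scalar_endo_def by (intro extensionalityI[of _ "verts Q"]) (auto simp: \<phi>v)
    then show ?thesis by blast
  qed
  then have "range (scalar_endo Q d) = End_rep Q d X" using scalars by blast
  then show ?thesis unfolding trivial_End_def bij_betw_def using inj by blast
qed

section \<open>The quiver of a free product of semisimple algebras\<close>

lemma sum_verts_Gamma: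
  "(\<Sum>v\<in>verts (Gamma m r w). g v) = g Sink + (\<Sum>i=1..m. \<Sum>j=1..r i. g (Source i j))"
proof -
  let ?P = "SIGMA i:{1..m}. {1..r i}"
  have "verts (Gamma m r w) = insert Sink ((\<lambda>(i, j). Source i j) ` ?P)"
    by (auto simp: Gamma_def)
  moreover have "Sink \<notin> (\<lambda>(i, j). Source i j) ` ?P" by auto
  moreover have "inj_on (\<lambda>(i, j). Source i j) ?P" by (auto simp: inj_on_def)
  ultimately have "(\<Sum>v\<in>verts (Gamma m r w). g v) = g Sink + (\<Sum>p\<in>?P. g (case p of (i, j) \<Rightarrow> Source i j))"
    by (simp add: sum.reindex)
  also have "(\<Sum>p\<in>?P. g (case p of (i, j) \<Rightarrow> Source i j)) = (\<Sum>i=1..m. \<Sum>j=1..r i. g (Source i j))"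
    by (subst sum.Sigma) (auto intro!: sum.cong)
  finally show ?thesis .
qed

lemma sum_arcs_Gamma:
  "(\<Sum>a\<in>arcs (Gamma m r w). g a) = (\<Sum>i=1..m. \<Sum>j=1..r i. \<Sum>k=1..w i j. g (i, j, k))"
proof -
  have "arcs (Gamma m r w) = (SIGMA i:{1..m}. SIGMA j:{1..r i}. {1..w i j})"
    by (auto simp: Gamma_def)
  then show ?thesis by (simp add: sum.Sigma split_def)
qed

lemma arcs_Gamma_iff:
  "(i, j, k) \<in> arcs (Gamma m r w) \<longleftrightarrow> i \<in> {1..m} \<and> j \<in> {1..r i} \<and> k \<in> {1..w i j}"
  by (simp add: Gamma_def)

lemma tail_head_Gamma: "tail (Gamma m r w) (i, j, k) = Source i j" "head (Gamma m r w) a = Sink"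
  by (simp_all add: Gamma_def)

lemma Sink_in_Gamma: "Sink \<in> verts (Gamma m r w)"
  and Source_in_Gamma: "i \<in> {1..m} \<Longrightarrow> j \<in> {1..r i} \<Longrightarrow> Source i j \<in> verts (Gamma m r w)"
  by (auto simp: Gamma_def)

text \<open>
  The columns of the block row that collects all arrows starting in the sources of the \<open>i\<close>-th factor.
  For a balanced dimension vector this block row is a square matrix, and if it is injective, the
  representation comes from an action of the \<open>i\<close>-th factor on the space at the sink.
\<close>
definition block_index :: "(nat \<Rightarrow> nat) \<Rightarrow> (nat \<Rightarrow> nat \<Rightarrow> nat) \<Rightarrow> (gamma_vertex \<Rightarrow> nat) \<Rightarrow> nat \<Rightarrow> (nat \<times> nat \<times> nat) set" where
  "block_index r w d i = (SIGMA j:{1..r i}. {1..w i j} \<times> {..<d (Source i j)})"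

definition block_injective :: "(nat \<Rightarrow> nat) \<Rightarrow> (nat \<Rightarrow> nat \<Rightarrow> nat) \<Rightarrow> (gamma_vertex \<Rightarrow> nat) \<Rightarrow> nat \<Rightarrow>
    ((nat \<times> nat \<times> nat) \<times> nat \<times> nat \<Rightarrow> 'k::field) \<Rightarrow> bool" where
  "block_injective r w d i f \<longleftrightarrow> (\<forall>x. supported_on (block_index r w d i) x \<longrightarrow>
     (\<forall>p\<in>{..<d Sink}. (\<Sum>(j, k, q)\<in>block_index r w d i. f ((i, j, k), p, q) * x (j, k, q)) = 0) \<longrightarrow>
     (\<forall>b. x b = 0))"

lemma finite_block_index: "finite (block_index r w d i)"
  by (simp add: block_index_def)

lemma card_block_index: "card (block_index r w d i) = (\<Sum>j=1..r i. w i j * d (Source i j))"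
  by (simp add: block_index_def card_cartesian_product)

text \<open>
  Matching the columns with the rows of the square matrix turns it into an identity matrix, which is
  an injective member of the family.
\<close>
lemma generically_block_injective:
  assumes "(\<Sum>j=1..r i. w i j * d (Source i j)) = d Sink"
  shows "generically (block_injective r w d i :: ((nat \<times> nat \<times> nat) \<times> nat \<times> nat \<Rightarrow> 'k::field) \<Rightarrow> bool)"
proof -
  let ?I = "block_index r w d i"
  have "card ?I = card {..<d Sink}" using assms by (simp add: card_block_index)
  then obtain e where e: "bij_betw e ?I {..<d Sink}"
    using finite_same_card_bij[OF finite_block_index finite_lessThan] by blast
  define f1 :: "(nat \<times> nat \<times> nat) \<times> nat \<times> nat \<Rightarrow> 'k" where
    "f1 = (\<lambda>((i', j, k), p, q). if e (j, k, q) = p then 1 else 0)"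
  show ?thesis
    unfolding block_injective_def
  proof (rule generically_injective[OF finite_block_index, where ?f0.0 = f1])
    show "linear_form (\<lambda>x. \<Sum>(j, k, q)\<in>?I. f ((i, j, k), p, q) * x (j, k, q))"
      for f :: "(nat \<times> nat \<times> nat) \<times> nat \<times> nat \<Rightarrow> 'k" and p
      unfolding split_def by (intro linear_form_intros)
    show "(\<Sum>(j, k, q)\<in>?I. segment f g t ((i, j, k), p, q) * x (j, k, q)) =
        (\<Sum>(j, k, q)\<in>?I. f ((i, j, k), p, q) * x (j, k, q)) +
        t * ((\<Sum>(j, k, q)\<in>?I. g ((i, j, k), p, q) * x (j, k, q)) -
          (\<Sum>(j, k, q)\<in>?I. f ((i, j, k), p, q) * x (j, k, q)))"
      for f g :: "(nat \<times> nat \<times> nat) \<times> nat \<times> nat \<Rightarrow> 'k" and t p x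
      unfolding split_def segment_def
      by (simp add: distrib_right right_diff_distrib left_diff_distrib sum.distrib sum_subtractf
          sum_distrib_left mult.assoc)
    fix x :: "nat \<times> nat \<times> nat \<Rightarrow> 'k"
    assume x: "supported_on ?I x" "\<forall>p\<in>{..<d Sink}. (\<Sum>(j, k, q)\<in>?I. f1 ((i, j, k), p, q) * x (j, k, q)) = 0"
    have "x b = 0" if b: "b \<in> ?I" for b
    proof -
      have "e b \<in> {..<d Sink}" using e b by (auto simp: bij_betw_def)
      then have "0 = (\<Sum>(j, k, q)\<in>?I. f1 ((i, j, k), e b, q) * x (j, k, q))" using x(2) by simp
      also have "\<dots> = (\<Sum>c\<in>?I. if c = b then x c else 0)"
      proof (intro sum.cong refl)
        fix c assume c: "c \<in> ?I"
        have "e c = e b \<longleftrightarrow> c = b" using e b c by (auto simp: bij_betw_def inj_on_def)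
        then show "(case c of (j, k, q) \<Rightarrow> f1 ((i, j, k), e b, q) * x (j, k, q)) = (if c = b then x c else 0)"
          by (cases c) (auto simp: f1_def)
      qed
      also have "\<dots> = x b" using b finite_block_index by simp
      finally show ?thesis by simp
    qed
    then show "\<forall>b. x b = 0" using x(1) unfolding supported_on_def by blast
  qed
qed

text \<open>
  The block row maps the direct sum of the subspaces at the sources into the subspace at the sink, so
  injectivity bounds the dimension of the former by that of the latter. With too many vectors at the
  sources, a nontrivial combination of their images would have zero coordinates in the subspace at
  the sink and would therefore vanish.
\<close>
lemma block_injective_subrepresentation:
  fixes f :: "(nat \<times> nat \<times> nat) \<times> nat \<times> nat \<Rightarrow> 'k::field"
  assumes i: "i \<in> {1..m}" and inj: "block_injective r w d i f"
    and N: "frame (Gamma m r w) d S N" and pr: "preserves (Gamma m r w) d S N f"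
  shows "(\<Sum>j=1..r i. w i j * card (S (Source i j))) \<le> card (S Sink)"
proof (rule ccontr)
  assume neg: "\<not> ?thesis"
  have S: "S v \<subseteq> {..<d v}" if "v \<in> verts (Gamma m r w)" for v using N that unfolding frame_def by blast
  have finS: "finite (S v)" if "v \<in> verts (Gamma m r w)" for v
    using S[OF that] by (metis finite_lessThan finite_subset)
  note src = Source_in_Gamma[OF i, where w = w and r = r]
  define K where "K = (SIGMA j:{1..r i}. {1..w i j} \<times> S (Source i j))"
  define Y where "Y j k p s = (\<Sum>q<d (Source i j). f ((i, j, k), p, q) * N (Source i j) q s)" for j k p s
  have finK: "finite K" unfolding K_def using finS[OF src] by (intro finite_SigmaI) auto
  have "card K = (\<Sum>j=1..r i. w i j * card (S (Source i j)))"
    unfolding K_def using finS[OF src] by (simp add: card_cartesian_product)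
  then have card: "card (S Sink) < card K" using neg by simp
  have "\<exists>y. supported_on K y \<and> (\<exists>b\<in>K. y b \<noteq> 0) \<and>
      (\<forall>p\<in>S Sink. (\<Sum>b\<in>K. Y (fst b) (fst (snd b)) p (snd (snd b)) * y b) = 0)"
    by (rule underdetermined_coefficients[OF finS[OF Sink_in_Gamma] finK card])
  then obtain y where y: "\<exists>b\<in>K. y b \<noteq> 0"
    and Yy: "\<And>p. p \<in> S Sink \<Longrightarrow> (\<Sum>b\<in>K. Y (fst b) (fst (snd b)) p (snd (snd b)) * y b) = 0" by blast
  have sumK: "(\<Sum>b\<in>K. g b) = (\<Sum>j=1..r i. \<Sum>k=1..w i j. \<Sum>s\<in>S (Source i j). g (j, k, s))"
    for g :: "nat \<times> nat \<times> nat \<Rightarrow> 'k"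
  proof -
    have "(\<Sum>b\<in>K. g b) = (\<Sum>j=1..r i. \<Sum>c\<in>{1..w i j} \<times> S (Source i j). g (j, c))"
      unfolding K_def using finS[OF src] by (subst sum.Sigma) (auto simp: split_def)
    then show ?thesis by (simp add: sum.cartesian_product split_def)
  qed
  have sumI: "(\<Sum>b\<in>block_index r w d i. g b) = (\<Sum>j=1..r i. \<Sum>k=1..w i j. \<Sum>q<d (Source i j). g (j, k, q))"
    for g :: "nat \<times> nat \<times> nat \<Rightarrow> 'k"
  proof -
    have "(\<Sum>b\<in>block_index r w d i. g b) = (\<Sum>j=1..r i. \<Sum>c\<in>{1..w i j} \<times> {..<d (Source i j)}. g (j, c))"
      unfolding block_index_def by (subst sum.Sigma) (auto simp: split_def)
    then show ?thesis by (simp add: sum.cartesian_product split_def)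
  qed
  define x where "x = (\<lambda>(j, k, q). if (j, k, q) \<in> block_index r w d i
    then (\<Sum>s\<in>S (Source i j). N (Source i j) q s * y (j, k, s)) else 0)"
  have "(\<Sum>(j, k, q)\<in>block_index r w d i. f ((i, j, k), p, q) * x (j, k, q)) = 0" if p: "p < d Sink" for p
  proof -
    have "(\<Sum>(j, k, q)\<in>block_index r w d i. f ((i, j, k), p, q) * x (j, k, q)) =
        (\<Sum>j=1..r i. \<Sum>k=1..w i j. \<Sum>q<d (Source i j). f ((i, j, k), p, q) * x (j, k, q))"
      by (simp add: sumI)
    also have "\<dots> = (\<Sum>j=1..r i. \<Sum>k=1..w i j. \<Sum>s\<in>S (Source i j). Y j k p s * y (j, k, s))"
    proof (rule sum.cong[OF refl], rule sum.cong[OF refl])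
      fix j k assume j: "j \<in> {1..r i}" and k: "k \<in> {1..w i j}"
      have "(\<Sum>q<d (Source i j). f ((i, j, k), p, q) * x (j, k, q)) =
          (\<Sum>q<d (Source i j). \<Sum>s\<in>S (Source i j). f ((i, j, k), p, q) * N (Source i j) q s * y (j, k, s))"
        using j k by (intro sum.cong) (auto simp: x_def block_index_def sum_distrib_left mult.assoc)
      then show "(\<Sum>q<d (Source i j). f ((i, j, k), p, q) * x (j, k, q)) = (\<Sum>s\<in>S (Source i j). Y j k p s * y (j, k, s))"
        unfolding Y_def sum_distrib_right by (subst (asm) sum.swap) simp
    qed
    also have "\<dots> = (\<Sum>j=1..r i. \<Sum>k=1..w i j. \<Sum>s\<in>S (Source i j).
        (\<Sum>l\<in>S Sink. N Sink p l * Y j k l s) * y (j, k, s))"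
    proof (intro sum.cong refl)
      fix j k s assume j: "j \<in> {1..r i}" and k: "k \<in> {1..w i j}" and s: "s \<in> S (Source i j)"
      have "(i, j, k) \<in> arcs (Gamma m r w)" using i j k by (simp add: arcs_Gamma_iff)
      then have "Y j k p s = (\<Sum>l\<in>S Sink. N Sink p l * Y j k l s)"
        using pr p s unfolding preserves_def Y_def by (force simp: tail_head_Gamma)
      then show "Y j k p s * y (j, k, s) = (\<Sum>l\<in>S Sink. N Sink p l * Y j k l s) * y (j, k, s)" by simp
    qed
    also have "\<dots> = (\<Sum>b\<in>K. \<Sum>l\<in>S Sink. N Sink p l * (Y (fst b) (fst (snd b)) l (snd (snd b)) * y b))"
      by (simp add: sumK sum_distrib_right mult.assoc)
    also have "\<dots> = (\<Sum>l\<in>S Sink. N Sink p l * (\<Sum>b\<in>K. Y (fst b) (fst (snd b)) l (snd (snd b)) * y b))"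
      by (subst sum.swap) (simp add: sum_distrib_left)
    also have "\<dots> = 0" using Yy by simp
    finally show ?thesis .
  qed
  moreover have "supported_on (block_index r w d i) x" by (auto simp: x_def supported_on_def)
  ultimately have x0: "x b = 0" for b using inj unfolding block_injective_def by blast
  have "y (j, k, s) = 0" if b: "(j, k, s) \<in> K" for j k s
  proof -
    have v: "Source i j \<in> verts (Gamma m r w)" and s: "s \<in> S (Source i j)" using b src by (auto simp: K_def)
    have "(j, k, s) \<in> block_index r w d i" using b S[OF v] by (auto simp: K_def block_index_def)
    then have "x (j, k, s) = y (j, k, s)" using frame_sum_left[OF N v s] by (simp add: x_def)
    then show ?thesis using x0 by simp
  qed
  then show False using y by auto
qed

lemma weight_Gamma:
  "weight (Gamma m r w) (gamma_theta m w) e =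
     (\<Sum>i=1..m. int (\<Sum>j=1..r i. w i j * e (Source i j)) - int (e Sink))"
  by (simp add: weight_def sum_verts_Gamma sum_subtractf)

text \<open>
  For a generic representation every factor contributes a nonpositive number to the weight of a
  subrepresentation. If the weight is 0, the dimension \<open>e\<close> of the subrepresentation is balanced, like
  \<open>d\<close>. But the Euler form is symmetric on balanced vectors, as the arrows contribute
  \<open>m * e Sink * (d Sink - e Sink)\<close> to it in either order; this contradicts the strict inequality
  between \<open>\<langle>e, d - e\<rangle>\<close> and \<open>\<langle>d - e, e\<rangle>\<close> for proper subrepresentations.
\<close>
lemma balanced_schur_root_stable:
  assumes inf: "infinite (UNIV :: 'k::field set)"
    and bal: "balanced m r w d" and schur: "schur_root TYPE('k) (Gamma m r w) d"
  shows "stable_dim_vector TYPE('k) (Gamma m r w) (gamma_theta m w) d"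
proof -
  let ?Q = "Gamma m r w"
  note Q = fin_digraph_Gamma[of m r w]
  obtain X0 :: "nat \<times> nat \<times> nat \<Rightarrow> 'k mat" where "is_rep ?Q d X0" "trivial_End ?Q d X0"
    using schur unfolding schur_root_def by blast
  then have "brick ?Q d (coords X0)" by (rule trivial_End_brick[OF Q])
  note stable = generically_canonically_stable[OF Q inf this]
  have bal_i: "(\<Sum>j=1..r i. w i j * d (Source i j)) = d Sink" if "i \<in> {1..m}" for i
    using bal that unfolding balanced_def by blast
  have "generically (\<lambda>f :: (nat \<times> nat \<times> nat) \<times> nat \<times> nat \<Rightarrow> 'k. \<forall>i\<in>{1..m}. block_injective r w d i f)"
    using bal_i by (intro generically_ball[OF inf] generically_block_injective) auto
  from generically_ex[OF generically_conj[OF inf stable this]]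
  obtain f :: "(nat \<times> nat \<times> nat) \<times> nat \<times> nat \<Rightarrow> 'k" where
    f: "(brick ?Q d f \<and> (\<forall>S N. frame ?Q d S N \<longrightarrow> preserves ?Q d S N f \<longrightarrow>
        (\<exists>v\<in>verts ?Q. S v \<noteq> {}) \<longrightarrow> (\<exists>v\<in>verts ?Q. S v \<noteq> {..<d v}) \<longrightarrow>
        (\<Sum>a\<in>arcs ?Q. card (S (tail ?Q a)) * (d (head ?Q a) - card (S (head ?Q a)))) <
        (\<Sum>a\<in>arcs ?Q. (d (tail ?Q a) - card (S (tail ?Q a))) * card (S (head ?Q a))))) \<and>
      (\<forall>i\<in>{1..m}. block_injective r w d i f)"
    by (rule exE)
  note brick = f[THEN conjunct1, THEN conjunct1]
  note canon = f[THEN conjunct1, THEN conjunct2, rule_format]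
  note block = f[THEN conjunct2, rule_format]
  define X where "X = rep_of_coords ?Q d f"
  have "is_rep ?Q d X"
    using bal by (simp add: is_rep_def X_def rep_of_coords_def balanced_def)
  moreover have "stable_rep ?Q (gamma_theta m w) d X"
    unfolding stable_rep_def
  proof (intro conjI allI impI)
    show "\<exists>v\<in>verts ?Q. d v \<noteq> 0" using brick unfolding brick_def by blast
    show "weight ?Q (gamma_theta m w) d = 0" unfolding weight_Gamma using bal_i by simp
    fix U assume U: "is_subrep ?Q d X U \<and> (\<exists>v\<in>verts ?Q. U v \<noteq> {0\<^sub>v (d v)}) \<and>
      (\<exists>v\<in>verts ?Q. U v \<noteq> carrier_vec (d v))"
    then obtain S N where N: "frame ?Q d S N" "preserves ?Q d S N f"
      and c: "\<And>v. v \<in> verts ?Q \<Longrightarrow> coordinatized (d v) (S v) (N v) (U v)"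
      using subrep_frame[OF Q, of d f U] unfolding X_def by blast
    define e where "e v = card (S v)" for v
    have dim: "subrep_dim ?Q d U v = e v" if v: "v \<in> verts ?Q" for v
      using U v coordinatized_dim[OF _ c[OF v]] by (simp add: is_subrep_def subrep_dim_def e_def)
    have ed: "e v \<le> d v" if "v \<in> verts ?Q" for v
      using N(1) that card_mono[of "{..<d v}" "S v"] unfolding frame_def e_def by simp
    have "\<exists>v\<in>verts ?Q. S v \<noteq> {}" "\<exists>v\<in>verts ?Q. S v \<noteq> {..<d v}"
      using U coordinatized_zero_iff[OF c] coordinatized_full_iff[OF c] by blast+
    note canon_S = canon[OF N this, folded e_def]
    define c where "c i = (\<Sum>j=1..r i. w i j * e (Source i j))" for i
    have le: "c i \<le> e Sink" if "i \<in> {1..m}" for i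
      unfolding c_def e_def using block_injective_subrepresentation[OF that block[OF that] N] .
    have weight_e: "weight ?Q (gamma_theta m w) (subrep_dim ?Q d U) = (\<Sum>i=1..m. int (c i) - int (e Sink))"
      unfolding c_def weight_Gamma[symmetric] weight_def using dim by (intro sum.cong) auto
    show "weight ?Q (gamma_theta m w) (subrep_dim ?Q d U) < 0"
    proof (rule ccontr)
      assume nonneg: "\<not> ?thesis"
      have bal_e: "c i = e Sink" if i: "i \<in> {1..m}" for i
      proof (rule ccontr)
        assume "c i \<noteq> e Sink"
        then have "c i < e Sink" using le[OF i] by simp
        then have "(\<Sum>i=1..m. int (c i) - int (e Sink)) < (\<Sum>i=1..m. 0)"
          using le i by (intro sum_strict_mono_ex1) auto
        then show False using nonneg unfolding weight_e by simp
      qed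
      have bal_de: "(\<Sum>j=1..r i. w i j * (d (Source i j) - e (Source i j))) = d Sink - e Sink"
        if i: "i \<in> {1..m}" for i
      proof -
        have "(\<Sum>j=1..r i. w i j * (d (Source i j) - e (Source i j))) + e Sink = d Sink"
          unfolding bal_e[OF i, symmetric] c_def bal_i[OF i, symmetric] sum.distrib[symmetric]
          using ed[OF Source_in_Gamma[OF i]] by (intro sum.cong) (auto simp: distrib_left[symmetric])
        then show ?thesis by simp
      qed
      have "(\<Sum>a\<in>arcs ?Q. e (tail ?Q a) * (d (head ?Q a) - e (head ?Q a))) =
          (\<Sum>i=1..m. c i * (d Sink - e Sink))"
        by (simp add: c_def sum_arcs_Gamma tail_head_Gamma sum_distrib_right mult.assoc)
      also have "\<dots> = (\<Sum>i=1..m. (\<Sum>j=1..r i. w i j * (d (Source i j) - e (Source i j))) * e Sink)"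
        using bal_e bal_de by (intro sum.cong) auto
      also have "\<dots> = (\<Sum>a\<in>arcs ?Q. (d (tail ?Q a) - e (tail ?Q a)) * e (head ?Q a))"
        by (simp add: sum_arcs_Gamma tail_head_Gamma sum_distrib_right mult.assoc)
      finally show False using canon_S by simp
    qed
  qed
  ultimately show ?thesis unfolding stable_dim_vector_def by blast
qed

text \<open>
  Euclid's argument: 1 plus the product of all linear factors would have no root.
\<close>
lemma infinite_alg_closed: "infinite (UNIV :: 'k::alg_closed_field set)"
proof
  assume fin: "finite (UNIV :: 'k set)"
  define p :: "'k poly" where "p = (\<Prod>a\<in>UNIV. [:- a, 1:]) + 1"
  have "poly p x = 1" for x
  proof -
    have "(\<Prod>a\<in>UNIV. poly [:- a, 1:] x) = 0"
      using fin by (intro prod_zero) (auto intro!: bexI[of _ x])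
    then show ?thesis by (simp add: p_def poly_prod)
  qed
  moreover have "degree p > 0"
  proof -
    have "degree (\<Prod>a\<in>UNIV. [:- a, 1:] :: 'k poly) = card (UNIV :: 'k set)"
      by (subst degree_prod_eq_sum_degree) auto
    moreover have "card (UNIV :: 'k set) > 0" using fin by (simp add: card_gt_0_iff)
    ultimately show ?thesis unfolding p_def by (subst degree_add_eq_left) auto
  qed
  ultimately show False using alg_closed_imp_poly_has_root by (metis zero_neq_one)
qed

theorem corollary6p3:
  fixes m :: nat and r :: "nat \<Rightarrow> nat" and w :: "nat \<Rightarrow> nat \<Rightarrow> nat"
  assumes "m \<ge> 1"
    and "\<And>i j. i \<in> {1..m} \<Longrightarrow> j \<in> {1..r i} \<Longrightarrow> w i j \<ge> 1"
    and "\<And>i. i \<in> {1..m} \<Longrightarrow> factor_dim r w i \<noteq> 1"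
  shows "{d. balanced m r w d \<and> schur_root TYPE('k::alg_closed_field) (Gamma m r w) d} =
         {d. balanced m r w d \<and> stable_dim_vector TYPE('k) (Gamma m r w) (gamma_theta m w) d}"
proof -
  have "schur_root TYPE('k) (Gamma m r w) d"
    if "stable_dim_vector TYPE('k) (Gamma m r w) (gamma_theta m w) d" for d
    using that stable_trivial_End[OF fin_digraph_Gamma]
    unfolding stable_dim_vector_def schur_root_def by blast
  then show ?thesis using balanced_schur_root_stable[OF infinite_alg_closed] by blast
qed

end
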